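(* Let $X,Y\in\mathbb R^{p\times m}$ have singular value decompositions $$X=A_1D_1B_1'+A_2D_2B_2',\qquad Y=\widehat A_1\widehat D_1\widehat B_1'+\widehat A_2\widehat D_2\widehat B_2',$$ with $D_1=\mathrm{diag}(d_1,\dots,d_r)$ and $\widehat D_1=\mathrm{diag}(\widehat d_1,\dots,\widehat d_r)$. Suppose there is a positive constant $\delta\in(0,d_r]$ such that $\|\widehat D_2\|_{\mathrm{op}}\le d_r-\delta$. Let $\|\cdot\|$ be any unitarily invariant norm, and let $\varepsilon=\|A_1'(X-Y)\|\vee\|(X-Y)B_1\|$. Then $$\bigl\|A_1D_1B_1'-\widehat A_1\widehat D_1\widehat B_1'\bigr\|\le\Bigl(\frac{\sqrt2\,(d_1+\widehat d_1)}{\delta}+1\Bigr)\varepsilon.$$ If further there is an absolute constant $\bar\kappa\ge1$ such that $d_1\vee\widehat d_1\le\bar\kappa d_r$, then there is a constant $C>0$ depending only on $\bar\kappa$ such that $$\bigl\|A_1B_1'-\widehat A_1\widehat B_1'\bigr\|\le\frac{C\varepsilon}{\delta}.$$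
   Context: $'$ denotes transpose, $\|\cdot\|_{\mathrm{op}}$ the operator norm, $a\vee b=\max(a,b)$. In the singular value decompositions the singular values are arranged in decreasing order, $D_1$ (resp. $\widehat D_1$) contains the $r$ largest singular values of $X$ (resp. $Y$), so $d_1\ge\cdots\ge d_r$ and $\widehat d_1\ge\cdots\ge\widehat d_r$, and $D_2,\widehat D_2$ contain the remaining ones; $[A_1,A_2]$, $[B_1,B_2]$, $[\widehat A_1,\widehat A_2]$, $[\widehat B_1,\widehat B_2]$ have orthonormal columns. A unitarily invariant norm is understood as a family of norms on matrices of all sizes, given by a common symmetric gauge function of the singular values (as for the Frobenius and operator norms). *)

theory Defs
  imports
    "HOL-Library.Multiset"
    "HOL-Computational_Algebra.Polynomial"
    "Jordan_Normal_Form.Char_Poly"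
begin

definition append_cols :: "'a :: zero mat \<Rightarrow> 'a mat \<Rightarrow> 'a mat" where
  "append_cols A B = four_block_mat A B (0\<^sub>m 0 (dim_col A)) (0\<^sub>m 0 (dim_col B))"

definition orthonormal_cols :: "real mat \<Rightarrow> bool" where
  "orthonormal_cols A \<longleftrightarrow> transpose_mat A * A = 1\<^sub>m (dim_col A)"

text \<open>Diagonal, possibly rectangular, with nonnegative decreasing diagonal entries.\<close>

definition decreasing_diagonal :: "real mat \<Rightarrow> bool" where
  "decreasing_diagonal D \<longleftrightarrow>
     diagonal_mat D \<and>
     (\<forall>i < min (dim_row D) (dim_col D). 0 \<le> D $$ (i, i)) \<and>
     (\<forall>i j. i \<le> j \<longrightarrow> j < min (dim_row D) (dim_col D) \<longrightarrow> D $$ (j, j) \<le> D $$ (i, i))"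

text \<open>
  The split singular value decomposition \<open>X = A\<^sub>1 D\<^sub>1 B\<^sub>1' + A\<^sub>2 D\<^sub>2 B\<^sub>2'\<close> of a \<open>p \<times> m\<close>
  matrix, where \<open>D\<^sub>1 = diag(d 1, \<dots>, d r)\<close> (the sequence \<open>d\<close> is indexed from 1, the
  matrix indices from 0).  The sizes of the remaining block \<open>D\<^sub>2\<close> are free, so that the
  decomposition may be thin, compact (zero singular values omitted) or full
  (\<open>[A\<^sub>1, A\<^sub>2]\<close> and \<open>[B\<^sub>1, B\<^sub>2]\<close> square, \<open>D\<^sub>2\<close> rectangular).  That \<open>D\<^sub>1\<close> holds the \<open>r\<close>
  largest singular values is the monotonicity of the diagonal of \<open>diag(D\<^sub>1, D\<^sub>2)\<close>.
\<close>

definition split_svd ::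
  "nat \<Rightarrow> nat \<Rightarrow> nat \<Rightarrow> real mat \<Rightarrow> real mat \<Rightarrow> (nat \<Rightarrow> real) \<Rightarrow> real mat \<Rightarrow>
   real mat \<Rightarrow> real mat \<Rightarrow> real mat \<Rightarrow> bool" where
  "split_svd p m r X A1 d B1 A2 D2 B2 \<longleftrightarrow>
     (\<exists>s t. let D1 = mat_diag r (\<lambda>i. d (Suc i)) in
        X \<in> carrier_mat p m \<and>
        A1 \<in> carrier_mat p r \<and> B1 \<in> carrier_mat m r \<and>
        A2 \<in> carrier_mat p s \<and> D2 \<in> carrier_mat s t \<and> B2 \<in> carrier_mat m t \<and>
        X = A1 * D1 * transpose_mat B1 + A2 * D2 * transpose_mat B2 \<and>
        orthonormal_cols (append_cols A1 A2) \<and>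
        orthonormal_cols (append_cols B1 B2) \<and>
        decreasing_diagonal (four_block_mat D1 (0\<^sub>m r t) (0\<^sub>m s r) D2))"

definition euclid_norm :: "real vec \<Rightarrow> real" where
  "euclid_norm v = sqrt (v \<bullet> v)"

definition op_norm :: "real mat \<Rightarrow> real" where
  "op_norm A =
     (SUP v \<in> {v \<in> carrier_vec (dim_col A). euclid_norm v \<le> 1}. euclid_norm (A *\<^sub>v v))"

text \<open>
  The singular values of \<open>A\<close> in decreasing order: square roots of the eigenvalues of
  \<open>A' A\<close>, counted with multiplicity.  The list has one entry per column of \<open>A\<close>, so for
  a wide matrix it is padded with zeros.
\<close>

definition singular_values :: "real mat \<Rightarrow> real list" where
  "singular_values A =
     rev (sorted_list_of_multiset
       (image_mset sqrt (proots (char_poly (transpose_mat A * A)))))"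

definition singular_value_seq :: "real mat \<Rightarrow> nat \<Rightarrow> real" where
  "singular_value_seq A i =
     (if i < length (singular_values A) then singular_values A ! i else 0)"

text \<open>
  A symmetric gauge function, defined on all finitely supported real sequences at once;
  \<open>\<real>\<^sup>n\<close> is embedded by padding with zeros.  Only values at finitely supported sequences are
  constrained.  No normalisation at \<open>(1, 0, 0, \<dots>)\<close> is imposed.
\<close>

definition finitely_supported :: "(nat \<Rightarrow> real) \<Rightarrow> bool" where
  "finitely_supported x \<longleftrightarrow> finite {i. x i \<noteq> 0}"

definition symmetric_gauge :: "((nat \<Rightarrow> real) \<Rightarrow> real) \<Rightarrow> bool" where
  "symmetric_gauge \<Phi> \<longleftrightarrow>
     (\<forall>x. finitely_supported x \<longrightarrow> 0 \<le> \<Phi> x \<and> (\<Phi> x = 0 \<longleftrightarrow> x = (\<lambda>_. 0))) \<and>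
     (\<forall>c x. finitely_supported x \<longrightarrow> \<Phi> (\<lambda>i. c * x i) = \<bar>c\<bar> * \<Phi> x) \<and>
     (\<forall>x y. finitely_supported x \<longrightarrow> finitely_supported y \<longrightarrow>
        \<Phi> (\<lambda>i. x i + y i) \<le> \<Phi> x + \<Phi> y) \<and>
     (\<forall>\<pi> x. finitely_supported x \<longrightarrow> bij \<pi> \<longrightarrow> \<Phi> (\<lambda>i. x (\<pi> i)) = \<Phi> x) \<and>
     (\<forall>x. finitely_supported x \<longrightarrow> \<Phi> (\<lambda>i. \<bar>x i\<bar>) = \<Phi> x)"

text \<open>A family of norms on the matrices of all sizes, given by one symmetric gauge function.\<close>

definition unitarily_invariant_norm :: "(real mat \<Rightarrow> real) \<Rightarrow> bool" where
  "unitarily_invariant_norm N \<longleftrightarrow>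
     (\<exists>\<Phi>. symmetric_gauge \<Phi> \<and> (\<forall>A. N A = \<Phi> (singular_value_seq A)))"

end

theory Submission
  imports Defs
begin

text \<open>
  Write \<open>E = X - Y\<close>, let \<open>Y\<^sub>2\<close> be the residual of \<open>Y\<close>, and put
  \<open>S = A\<^sub>1' (1 - Ah\<^sub>1 Ah\<^sub>1')\<close>, \<open>R = B\<^sub>1' (1 - Bh\<^sub>1 Bh\<^sub>1')\<close>.  Then
  \<open>D\<^sub>1 R = A\<^sub>1' E (1 - Bh\<^sub>1 Bh\<^sub>1') + S Y\<^sub>2\<close>, and symmetrically for \<open>S\<close>; since \<open>Y\<^sub>2\<close> has
  operator norm at most \<open>d\<^sub>r - \<delta>\<close>, the two relations together give Wedin's bound
  \<open>N S, N R \<le> \<epsilon> / \<delta>\<close>.  The first claim follows by splitting \<open>A\<^sub>1 D\<^sub>1 B\<^sub>1' - Ah\<^sub>1 Dh\<^sub>1 Bh\<^sub>1'\<close> along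
  the range of \<open>A\<^sub>1\<close> and its complement, even without the factor \<open>\<surd>2\<close>.

  For the second claim the only component that is not a multiple of \<open>S\<close> or \<open>R\<close> is
  \<open>W = 1 - M K'\<close> with \<open>M = A\<^sub>1' Ah\<^sub>1\<close> and \<open>K = B\<^sub>1' Bh\<^sub>1\<close>.  With the positive semidefinite
  matrix \<open>H = M Dh\<^sub>1 M'\<close> it satisfies a Sylvester equation \<open>H W + W D\<^sub>1 = O(d\<^sub>r \<epsilon> / \<delta>)\<close>, and
  \<open>D\<^sub>1 \<ge> d\<^sub>r\<close> yields \<open>N W = O(\<epsilon> / \<delta>)\<close>.

  That a symmetric gauge of the singular values is a norm compatible with contractions is reduced,
  by weak majorization, to the Ky Fan sums
  \<open>\<sigma>\<^sub>1 + \<dots> + \<sigma>\<^sub>k = max tr (U' A V)\<close> over contractions \<open>U\<close>, \<open>V\<close> with \<open>k\<close> columns.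
\<close>

section \<open>Symmetric gauge functions and weak majorization\<close>

lemma symmetric_gaugeD:
  assumes "symmetric_gauge \<Phi>"
  shows gauge_nonneg: "finitely_supported x \<Longrightarrow> 0 \<le> \<Phi> x"
    and gauge_mult: "finitely_supported x \<Longrightarrow> \<Phi> (\<lambda>i. c * x i) = \<bar>c\<bar> * \<Phi> x"
    and gauge_triangle: "finitely_supported x \<Longrightarrow> finitely_supported y \<Longrightarrow>
      \<Phi> (\<lambda>i. x i + y i) \<le> \<Phi> x + \<Phi> y"
    and gauge_permute: "finitely_supported x \<Longrightarrow> bij \<pi> \<Longrightarrow> \<Phi> (\<lambda>i. x (\<pi> i)) = \<Phi> x"
    and gauge_abs: "finitely_supported x \<Longrightarrow> \<Phi> (\<lambda>i. \<bar>x i\<bar>) = \<Phi> x"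
proof -
  note g = assms[unfolded symmetric_gauge_def]
  note g1 = g[THEN conjunct1] and g2 = g[THEN conjunct2, THEN conjunct1]
    and g3 = g[THEN conjunct2, THEN conjunct2, THEN conjunct1]
    and g4 = g[THEN conjunct2, THEN conjunct2, THEN conjunct2, THEN conjunct1]
    and g5 = g[THEN conjunct2, THEN conjunct2, THEN conjunct2, THEN conjunct2]
  show "finitely_supported x \<Longrightarrow> 0 \<le> \<Phi> x" by (simp add: g1)
  show "finitely_supported x \<Longrightarrow> \<Phi> (\<lambda>i. c * x i) = \<bar>c\<bar> * \<Phi> x"
    by (rule g2[rule_format])
  show "finitely_supported x \<Longrightarrow> finitely_supported y \<Longrightarrow>
      \<Phi> (\<lambda>i. x i + y i) \<le> \<Phi> x + \<Phi> y" by (rule g3[rule_format])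
  show "finitely_supported x \<Longrightarrow> bij \<pi> \<Longrightarrow> \<Phi> (\<lambda>i. x (\<pi> i)) = \<Phi> x"
    by (rule g4[rule_format])
  show "finitely_supported x \<Longrightarrow> \<Phi> (\<lambda>i. \<bar>x i\<bar>) = \<Phi> x" by (rule g5[rule_format])
qed

lemma finitely_supported_mult:
  "finitely_supported x \<Longrightarrow> finitely_supported (\<lambda>i. c * x i)"
  unfolding finitely_supported_def by (rule rev_finite_subset) auto

text \<open>Sublevel sets of a gauge are convex. In both uses below \<open>z\<close> is
  \<open>y\<close> with two coordinates exchanged or one sign changed, so \<open>eq\<close> holds by
  symmetry.\<close>

lemma gauge_convex:
  assumes g: "symmetric_gauge \<Phi>" and f: "finitely_supported y" "finitely_supported z"
    and eq: "\<Phi> z = \<Phi> y" and t: "0 \<le> t" "t \<le> 1"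
  shows "\<Phi> (\<lambda>i. (1 - t) * y i + t * z i) \<le> \<Phi> y"
proof -
  have "\<Phi> (\<lambda>i. (1 - t) * y i + t * z i) \<le> \<Phi> (\<lambda>i. (1 - t) * y i) + \<Phi> (\<lambda>i. t * z i)"
    by (intro gauge_triangle[OF g] finitely_supported_mult f)
  also have "\<dots> = \<bar>1 - t\<bar> * \<Phi> y + \<bar>t\<bar> * \<Phi> z"
    by (simp only: gauge_mult[OF g f(1)] gauge_mult[OF g f(2)])
  finally show ?thesis using t eq by (simp add: algebra_simps)
qed

text \<open>A Robin Hood transfer is a mixture of \<open>y\<close> and its copy with coordinates
  \<open>j\<close> and \<open>k\<close> exchanged; the copy gets weight
  \<open>\<delta> / (y j - y k)\<close>.\<close>

lemma gauge_transfer: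
  assumes g: "symmetric_gauge \<Phi>" and fy: "finitely_supported y" and "j \<noteq> k"
    and \<delta>: "0 \<le> \<delta>" "\<delta> \<le> y j - y k"
  shows "\<Phi> (y(j := y j - \<delta>, k := y k + \<delta>)) \<le> \<Phi> y"
proof (cases "y j = y k")
  case True
  with \<delta> have "\<delta> = 0" by simp
  then show ?thesis by simp
next
  case False
  define t where "t = \<delta> / (y j - y k)"
  have t: "0 \<le> t" "t \<le> 1" using \<delta> False by (auto simp: t_def divide_simps)
  have td: "t * (y j - y k) = \<delta>" using False by (simp add: t_def)
  define \<pi> where "\<pi> = (id(j := k, k := j) :: nat \<Rightarrow> nat)"
  have inv: "\<pi> (\<pi> i) = i" for i using \<open>j \<noteq> k\<close> by (auto simp: \<pi>_def)
  have bij: "bij \<pi>" by (rule bijI') (metis inv)+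
  define z where "z = (\<lambda>i. y (\<pi> i))"
  have fz: "finitely_supported z"
  proof -
    have "{i. z i \<noteq> 0} \<subseteq> \<pi> ` {i. y i \<noteq> 0}"
      by (auto simp: z_def image_iff) (metis inv)
    then show ?thesis using fy unfolding finitely_supported_def by (meson finite_imageI finite_subset)
  qed
  have eq: "y(j := y j - \<delta>, k := y k + \<delta>) = (\<lambda>i. (1 - t) * y i + t * z i)"
  proof
    fix i
    show "(y(j := y j - \<delta>, k := y k + \<delta>)) i = (1 - t) * y i + t * z i"
      using \<open>j \<noteq> k\<close> td by (auto simp: z_def \<pi>_def algebra_simps)
  qed
  have "\<Phi> z = \<Phi> y" unfolding z_def by (rule gauge_permute[OF g fy bij])
  from gauge_convex[OF g fy fz this t] show ?thesis by (simp only: eq)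
qed

text \<open>Mixing \<open>y\<close> with its copy negated at coordinate \<open>j\<close> multiplies
  that coordinate by \<open>1 - 2 * t\<close>; the weight \<open>t\<close> is solved from the target
  value \<open>x\<close>.\<close>

lemma gauge_shrink:
  assumes g: "symmetric_gauge \<Phi>" and fy: "finitely_supported y"
    and x: "0 \<le> x" "x \<le> y j"
  shows "\<Phi> (y(j := x)) \<le> \<Phi> y"
proof (cases "y j = 0")
  case True
  with x have "y(j := x) = y" by auto
  then show ?thesis by simp
next
  case False
  define t where "t = (1 - x / y j) / 2"
  have t: "0 \<le> t" "t \<le> 1" using x False by (auto simp: t_def divide_simps)
  have td: "(1 - 2 * t) * y j = x" using False by (simp add: t_def field_simps)
  define z where "z = y(j := - y j)"
  have fz: "finitely_supported z"
    using fy unfolding finitely_supported_def by (rule rev_finite_subset) (auto simp: z_def)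
  have eq: "y(j := x) = (\<lambda>i. (1 - t) * y i + t * z i)"
    using td by (auto simp: z_def fun_eq_iff algebra_simps)
  have "\<Phi> z = \<Phi> (\<lambda>i. \<bar>z i\<bar>)" by (rule gauge_abs[OF g fz, symmetric])
  also have "(\<lambda>i. \<bar>z i\<bar>) = (\<lambda>i. \<bar>y i\<bar>)" by (auto simp: z_def)
  also have "\<Phi> (\<lambda>i. \<bar>y i\<bar>) = \<Phi> y" by (rule gauge_abs[OF g fy])
  finally have "\<Phi> z = \<Phi> y" .
  from gauge_convex[OF g fy fz this t] show ?thesis by (simp only: eq)
qed

text \<open>Only \<open>x\<close> has to be monotone; this makes the induction on the number of differing
  coordinates go through, since a transfer step need not preserve the monotonicity of \<open>y\<close>.\<close>

lemma gauge_weak_majorization: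
  assumes g: "symmetric_gauge \<Phi>"
    and fx: "finitely_supported x" and fy: "finitely_supported y"
    and x0: "\<And>i. 0 \<le> x i" and dec: "\<And>i j. i \<le> j \<Longrightarrow> x j \<le> x i"
    and maj: "\<And>n. (\<Sum>i<n. x i) \<le> (\<Sum>i<n. y i)"
  shows "\<Phi> x \<le> \<Phi> y"
  using fy maj
proof (induction "card {i. x i \<noteq> y i}" arbitrary: y rule: less_induct)
  case less
  have fin: "finite {i. x i \<noteq> y i}"
    by (rule finite_subset[of _ "{i. x i \<noteq> 0} \<union> {i. y i \<noteq> 0}"])
      (use fx less.prems(1) in \<open>auto simp: finitely_supported_def\<close>)
  show ?case
  proof (cases "\<exists>k. x k > y k")
    case False
    \<comment> \<open>Without an excess coordinate, \<open>y\<close> is lowered to \<open>x\<close>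
      one coordinate at a time.\<close>
    then have le: "x i \<le> y i" for i by (simp add: not_less)
    show ?thesis
    proof (cases "x = y")
      case False
      then obtain j where j: "x j \<noteq> y j" by auto
      let ?y = "y(j := x j)"
      have "{i. x i \<noteq> ?y i} \<subset> {i. x i \<noteq> y i}" using j by auto
      then have "card {i. x i \<noteq> ?y i} < card {i. x i \<noteq> y i}" by (rule psubset_card_mono[OF fin])
      moreover have "finitely_supported ?y"
        unfolding finitely_supported_def
        by (rule finite_subset[OF _ finite.insertI[OF less.prems(1)[unfolded finitely_supported_def], of j]]) auto
      moreover have "(\<Sum>i<n. x i) \<le> (\<Sum>i<n. ?y i)" for n using le by (intro sum_mono) auto
      ultimately have "\<Phi> x \<le> \<Phi> ?y" by (rule less.hyps)
      also have "\<dots> \<le> \<Phi> y" by (rule gauge_shrink[OF g less.prems(1) x0 le])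
      finally show ?thesis .
    qed simp
  next
    case True
    define k where "k = (LEAST k. x k > y k)"
    have k: "x k > y k" unfolding k_def using True by (rule LeastI_ex)
    have kmin: "x i \<le> y i" if "i < k" for i using not_less_Least[OF that[unfolded k_def]] by (simp add: not_less)
    \<comment> \<open>Before the first excess \<open>k\<close> some coordinate must have a surplus,
      otherwise the prefix sums of length \<open>Suc k\<close> would contradict the
      majorization.\<close>
    have "\<exists>j<k. y j > x j"
    proof (rule ccontr)
      assume "\<not> ?thesis"
      then have "x i = y i" if "i < k" for i using kmin[OF that] that by (meson antisym not_less)
      then have "(\<Sum>i<k. x i) = (\<Sum>i<k. y i)" by (intro sum.cong) auto
      with less.prems(2)[of "Suc k"] k show False by simp
    qed
    then obtain j where j: "j < k" "y j > x j" by blast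
    \<comment> \<open>The largest amount that overshoots neither target. Coordinate \<open>j\<close>
      or \<open>k\<close> then agrees with \<open>x\<close>, so the number of differing coordinates
      drops.\<close>
    define \<delta> where "\<delta> = min (y j - x j) (x k - y k)"
    have \<delta>: "0 < \<delta>" "\<delta> \<le> y j - x j" "\<delta> \<le> x k - y k" using j k by (auto simp: \<delta>_def)
    let ?y = "y(j := y j - \<delta>, k := y k + \<delta>)"
    have "x j = ?y j \<or> x k = ?y k" using j by (auto simp: \<delta>_def min_def)
    then have "{i. x i \<noteq> ?y i} \<subset> {i. x i \<noteq> y i}"
    proof -
      have "{i. x i \<noteq> ?y i} \<subseteq> {i. x i \<noteq> y i}" using j k by auto
      moreover have "x j \<noteq> y j" "x k \<noteq> y k" using j k by auto
      moreover assume "x j = ?y j \<or> x k = ?y k"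
      ultimately show ?thesis by blast
    qed
    then have "card {i. x i \<noteq> ?y i} < card {i. x i \<noteq> y i}" by (rule psubset_card_mono[OF fin])
    moreover have "finitely_supported ?y"
      unfolding finitely_supported_def
      by (rule finite_subset[of _ "{j, k} \<union> {i. y i \<noteq> 0}"])
        (use less.prems(1) in \<open>auto simp: finitely_supported_def\<close>)
    \<comment> \<open>Up to \<open>k\<close> the comparison is termwise. Beyond \<open>k\<close>
      both ends of the transfer lie inside the prefix, so its sum is unchanged.\<close>
    moreover have "(\<Sum>i<n. x i) \<le> (\<Sum>i<n. ?y i)" for n
    proof (cases "n \<le> k")
      case True
      show ?thesis using True j kmin \<delta> by (intro sum_mono) auto
    next
      case False
      have "(\<Sum>i<n. ?y i) = (\<Sum>i<n. y i + ((if i = k then \<delta> else 0) - (if i = j then \<delta> else 0)))"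
        using j by (intro sum.cong) auto
      also have "\<dots> = (\<Sum>i<n. y i)" using j False by (simp add: sum.distrib sum_subtractf)
      finally show ?thesis using less.prems(2) by simp
    qed
    ultimately have "\<Phi> x \<le> \<Phi> ?y" by (rule less.hyps)
    also have "\<dots> \<le> \<Phi> y"
    proof (rule gauge_transfer[OF g less.prems(1)])
      \<comment> \<open>Monotonicity of \<open>x\<close> enters here:
        \<open>y j - \<delta> \<ge> x j \<ge> x k \<ge> y k + \<delta>\<close>.\<close>
      show "\<delta> \<le> y j - y k" using \<delta> dec[of j k] j by simp
    qed (use j \<delta> in auto)
    finally show ?thesis .
  qed
qed

section \<open>Operator norm bounds\<close>

lemma mat_assoc:
  fixes A :: "'a::semiring_0 mat"
  assumes "dim_col A = dim_row B" "dim_col B = dim_row C"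
  shows "A * B * C = A * (B * C)"
  using assms by (intro assoc_mult_mat[of _ "dim_row A" "dim_col A" _ "dim_col B" _ "dim_col C"]) auto

lemma mat_distribs:
  fixes A :: "'a::ring mat"
  shows "dim_row B = dim_row C \<Longrightarrow> dim_col B = dim_col C \<Longrightarrow> dim_col A = dim_row C \<Longrightarrow>
      A * (B + C) = A * B + A * C"
    and "dim_row B = dim_row C \<Longrightarrow> dim_col B = dim_col C \<Longrightarrow> dim_col A = dim_row C \<Longrightarrow>
      A * (B - C) = A * B - A * C"
    and "dim_row B = dim_row C \<Longrightarrow> dim_col B = dim_col C \<Longrightarrow> dim_row A = dim_col C \<Longrightarrow>
      (B + C) * A = B * A + C * A"
    and "dim_row B = dim_row C \<Longrightarrow> dim_col B = dim_col C \<Longrightarrow> dim_row A = dim_col C \<Longrightarrow>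
      (B - C) * A = B * A - C * A"
  by (intro mult_add_distrib_mat[of _ "dim_row A" "dim_col A" _ "dim_col B"]
      mult_minus_distrib_mat[of _ "dim_row A" "dim_col A" _ "dim_col B"]
      add_mult_distrib_mat[of _ "dim_row B" "dim_col B" _ _ "dim_col A"]
      minus_mult_distrib_mat[of _ "dim_row B" "dim_col B" _ _ "dim_col A"]; auto)+

lemma mat_one_mult:
  fixes A :: "'a::semiring_1 mat"
  shows "dim_row A = n \<Longrightarrow> 1\<^sub>m n * A = A" and "dim_col A = n \<Longrightarrow> A * 1\<^sub>m n = A"
  by auto

lemma mat_transposes:
  fixes A :: "'a::comm_ring mat"
  shows "dim_col A = dim_row B \<Longrightarrow> (A * B)\<^sup>T = B\<^sup>T * A\<^sup>T"
    and "dim_row A = dim_row C \<Longrightarrow> dim_col A = dim_col C \<Longrightarrow> (A + C)\<^sup>T = A\<^sup>T + C\<^sup>T"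
    and "dim_row A = dim_row C \<Longrightarrow> dim_col A = dim_col C \<Longrightarrow> (A - C)\<^sup>T = A\<^sup>T - C\<^sup>T"
proof -
  show "dim_col A = dim_row B \<Longrightarrow> (A * B)\<^sup>T = B\<^sup>T * A\<^sup>T"
    by (rule transpose_mult[of _ "dim_row A" "dim_col A" _ "dim_col B"]) auto
qed auto

lemma transpose_mat_diag [simp]: "(mat_diag n f)\<^sup>T = mat_diag n f"
  by (rule eq_matI) (auto simp: mat_diag_def)

lemma dim_mat_diag [simp]: "dim_row (mat_diag n f) = n" "dim_col (mat_diag n f) = n"
  by (auto simp: mat_diag_def)

lemma scalar_prod_self_nonneg: "0 \<le> v \<bullet> (v :: real vec)"
  unfolding scalar_prod_def by (intro sum_nonneg) auto

lemma scalar_prod_Cauchy_Schwarz: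
  fixes u v :: "real vec"
  assumes "dim_vec u = dim_vec v"
  shows "(u \<bullet> v)\<^sup>2 \<le> (u \<bullet> u) * (v \<bullet> v)"
proof -
  let ?I = "{0..<dim_vec v}"
  define a b c where "a = u \<bullet> u" and "b = u \<bullet> v" and "c = v \<bullet> v"
  have sums: "a = (\<Sum>i\<in>?I. u $ i * u $ i)" "b = (\<Sum>i\<in>?I. u $ i * v $ i)" "c = (\<Sum>i\<in>?I. v $ i * v $ i)"
    using assms by (simp_all add: a_def b_def c_def scalar_prod_def)
  \<comment> \<open>The sum is the squared length of a v - b u, which expands to a (a c -
    b^2).\<close>
  have "0 \<le> (\<Sum>i\<in>?I. (a * v $ i - b * u $ i)\<^sup>2)" by (intro sum_nonneg) auto
  also have "\<dots> = (\<Sum>i\<in>?I. a\<^sup>2 * (v $ i * v $ i) - 2 * a * b * (u $ i * v $ i) + b\<^sup>2 * (u $ i * u $ i))"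
    by (intro sum.cong) (auto simp: power2_eq_square algebra_simps)
  also have "\<dots> = a\<^sup>2 * c - 2 * a * b * b + b\<^sup>2 * a"
    by (simp only: sum.distrib sum_subtractf sum_distrib_left[symmetric] sums[symmetric])
  also have "\<dots> = a * (a * c - b\<^sup>2)" by (simp add: power2_eq_square algebra_simps)
  finally have *: "0 \<le> a * (a * c - b\<^sup>2)" .
  have "a \<ge> 0" unfolding a_def by (rule scalar_prod_self_nonneg)
  show ?thesis
  proof (cases "a = 0")
    case True
    then have "\<forall>i\<in>?I. u $ i * u $ i = 0"
      unfolding sums(1) by (subst (asm) sum_nonneg_eq_0_iff) auto
    then have "b = 0" unfolding sums(2) by simp
    then show ?thesis using True by (simp add: a_def b_def)
  next
    case False
    with \<open>a \<ge> 0\<close> * have "0 \<le> a * c - b\<^sup>2" by (simp add: zero_le_mult_iff)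
    then show ?thesis by (simp add: a_def b_def c_def)
  qed
qed

lemma scalar_prod_mult_mat_vec:
  fixes A :: "real mat"
  assumes "dim_vec v = dim_col A" "dim_vec u = dim_row A"
  shows "(A *\<^sub>v v) \<bullet> u = v \<bullet> (A\<^sup>T *\<^sub>v u)"
proof -
  have "u \<bullet> (A *\<^sub>v v) = (A\<^sup>T *\<^sub>v u) \<bullet> v"
    using assms by (intro transpose_vec_mult_scalar[symmetric, of _ "dim_row A" "dim_col A"]) (auto intro: carrier_vecI)
  then show ?thesis
    using assms by (metis carrier_vecI comm_scalar_prod dim_mult_mat_vec index_transpose_mat(2))
qed

text \<open>A bound on squared lengths avoids the supremum and composes directly. The conjunct
  \<open>0 \<le> c\<close> matters because \<open>c\<close> otherwise enters only through its
  square.\<close>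

definition op_bound :: "real \<Rightarrow> real mat \<Rightarrow> bool" where
  "op_bound c A \<longleftrightarrow> 0 \<le> c \<and>
    (\<forall>v \<in> carrier_vec (dim_col A). (A *\<^sub>v v) \<bullet> (A *\<^sub>v v) \<le> c\<^sup>2 * (v \<bullet> v))"

lemma op_boundD: "op_bound c A \<Longrightarrow> dim_vec v = dim_col A \<Longrightarrow> (A *\<^sub>v v) \<bullet> (A *\<^sub>v v) \<le> c\<^sup>2 * (v \<bullet> v)"
  by (auto simp: op_bound_def intro: carrier_vecI)

lemma op_bound_nonneg: "op_bound c A \<Longrightarrow> 0 \<le> c"
  by (simp add: op_bound_def)

lemma op_bound_mono:
  assumes "op_bound c A" "c \<le> d"
  shows "op_bound d A"
proof -
  have "c\<^sup>2 * (v \<bullet> v) \<le> d\<^sup>2 * (v \<bullet> v)" for v :: "real vec"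
    using assms op_bound_nonneg[OF assms(1)]
    by (intro mult_right_mono power_mono scalar_prod_self_nonneg) auto
  then show ?thesis using assms unfolding op_bound_def by (meson order_trans)
qed

lemma op_bound_mult:
  assumes "op_bound c A" "op_bound d B" "dim_col A = dim_row B"
  shows "op_bound (c * d) (A * B)"
  unfolding op_bound_def
proof (intro conjI ballI)
  show "0 \<le> c * d" using assms op_bound_nonneg by auto
  fix v :: "real vec" assume "v \<in> carrier_vec (dim_col (A * B))"
  then have v: "dim_vec v = dim_col B" by auto
  have eq: "A * B *\<^sub>v v = A *\<^sub>v (B *\<^sub>v v)"
    using assms v by (intro assoc_mult_mat_vec[of _ "dim_row A" "dim_col A" _ "dim_col B"]) (auto intro: carrier_vecI)
  have "(A *\<^sub>v (B *\<^sub>v v)) \<bullet> (A *\<^sub>v (B *\<^sub>v v)) \<le> c\<^sup>2 * ((B *\<^sub>v v) \<bullet> (B *\<^sub>v v))"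
    using assms by (intro op_boundD) auto
  also have "\<dots> \<le> c\<^sup>2 * (d\<^sup>2 * (v \<bullet> v))" using assms v by (intro mult_left_mono op_boundD) auto
  finally show "(A * B *\<^sub>v v) \<bullet> (A * B *\<^sub>v v) \<le> (c * d)\<^sup>2 * (v \<bullet> v)"
    by (simp add: eq power_mult_distrib mult.assoc)
qed

text \<open>For \<open>w = A\<^sup>T *\<^sub>v v\<close> the product \<open>w \<bullet> w\<close>
  equals \<open>(A *\<^sub>v w) \<bullet> v\<close>. Cauchy-Schwarz bounds its square by
  \<open>c\<^sup>2 * (w \<bullet> w) * (v \<bullet> v)\<close>, and one factor
  \<open>w \<bullet> w\<close> cancels.\<close>

lemma op_bound_transpose:
  assumes A: "op_bound c A"
  shows "op_bound c A\<^sup>T"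
  unfolding op_bound_def
proof (intro conjI ballI)
  show "0 \<le> c" using A by (rule op_bound_nonneg)
  fix v :: "real vec" assume "v \<in> carrier_vec (dim_col A\<^sup>T)"
  then have v: "dim_vec v = dim_row A" by auto
  define w where "w = A\<^sup>T *\<^sub>v v"
  have w: "dim_vec w = dim_col A" by (simp add: w_def)
  have ww: "w \<bullet> w = (A *\<^sub>v w) \<bullet> v" using scalar_prod_mult_mat_vec[OF w v] by (simp add: w_def)
  have "(w \<bullet> w) * (w \<bullet> w) \<le> ((A *\<^sub>v w) \<bullet> (A *\<^sub>v w)) * (v \<bullet> v)"
    unfolding ww using scalar_prod_Cauchy_Schwarz[of "A *\<^sub>v w" v] v by (simp add: power2_eq_square)
  also have "\<dots> \<le> (c\<^sup>2 * (w \<bullet> w)) * (v \<bullet> v)"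
    by (intro mult_right_mono op_boundD A w scalar_prod_self_nonneg)
  finally have "(w \<bullet> w) * (w \<bullet> w) \<le> (w \<bullet> w) * (c\<^sup>2 * (v \<bullet> v))" by (simp add: mult_ac)
  moreover have "0 \<le> c\<^sup>2 * (v \<bullet> v)" by (simp add: scalar_prod_self_nonneg)
  moreover have "0 \<le> w \<bullet> w" by (rule scalar_prod_self_nonneg)
  ultimately show "(A\<^sup>T *\<^sub>v v) \<bullet> (A\<^sup>T *\<^sub>v v) \<le> c\<^sup>2 * (v \<bullet> v)"
    unfolding w_def[symmetric] by (cases "w \<bullet> w = 0") auto
qed

lemma op_bound_orthonormal:
  assumes "A\<^sup>T * A = 1\<^sub>m (dim_col A)"
  shows "op_bound 1 A"
proof -
  have "(A *\<^sub>v v) \<bullet> (A *\<^sub>v v) = v \<bullet> v" if v: "v \<in> carrier_vec (dim_col A)" for v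
  proof -
    have "(A *\<^sub>v v) \<bullet> (A *\<^sub>v v) = v \<bullet> (A\<^sup>T *\<^sub>v (A *\<^sub>v v))"
      using v by (intro scalar_prod_mult_mat_vec) auto
    also have "A\<^sup>T *\<^sub>v (A *\<^sub>v v) = A\<^sup>T * A *\<^sub>v v"
      using v by (intro assoc_mult_mat_vec[symmetric, of _ "dim_col A" "dim_row A" _ "dim_col A"]) auto
    also have "\<dots> = v" using v assms by simp
    finally show ?thesis .
  qed
  then show ?thesis by (auto simp: op_bound_def)
qed

text \<open>With \<open>w = C\<^sup>T *\<^sub>v v\<close> the image of \<open>v\<close> has squared
  length t^2 |v|^2 - 2 t |w|^2 + |C w|^2, and |C w|^2 \<le> |w|^2 \<le> 2 t |w|^2. The case
  \<open>t = 1\<close> gives complements of projections, \<open>t = 1 / 2\<close> serves the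
  Sylvester equation.\<close>

lemma op_bound_scalar_minus_gram:
  assumes C: "op_bound 1 C" and n: "dim_row C = n" and t: "1 / 2 \<le> t"
  shows "op_bound t (t \<cdot>\<^sub>m 1\<^sub>m n - C * C\<^sup>T)"
  unfolding op_bound_def
proof (intro conjI ballI)
  show "0 \<le> t" using t by simp
  fix v :: "real vec" assume "v \<in> carrier_vec (dim_col (t \<cdot>\<^sub>m 1\<^sub>m n - C * C\<^sup>T))"
  then have v: "v \<in> carrier_vec n" using n by simp
  define w where "w = C\<^sup>T *\<^sub>v v"
  have w: "w \<in> carrier_vec (dim_col C)" by (simp add: w_def carrier_vecI)
  have Cw: "C *\<^sub>v w \<in> carrier_vec n" using n by (simp add: carrier_vecI)
  have "(t \<cdot>\<^sub>m 1\<^sub>m n - C * C\<^sup>T) *\<^sub>v v = (t \<cdot>\<^sub>m 1\<^sub>m n) *\<^sub>v v - (C * C\<^sup>T) *\<^sub>v v"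
    using v n by (intro minus_mult_distrib_mat_vec[of _ n n]) auto
  also have "(t \<cdot>\<^sub>m 1\<^sub>m n) *\<^sub>v v = t \<cdot>\<^sub>v v"
    using v by (intro eq_vecI) auto
  also have "(C * C\<^sup>T) *\<^sub>v v = C *\<^sub>v w"
    unfolding w_def using v n by (intro assoc_mult_mat_vec[of _ n "dim_col C" _ n]) auto
  finally have eq: "(t \<cdot>\<^sub>m 1\<^sub>m n - C * C\<^sup>T) *\<^sub>v v = t \<cdot>\<^sub>v v - C *\<^sub>v w" .
  have Cwv: "(C *\<^sub>v w) \<bullet> v = w \<bullet> w"
    using scalar_prod_mult_mat_vec[of w C v] v w n by (simp add: w_def)
  then have vCw: "v \<bullet> (C *\<^sub>v w) = w \<bullet> w" using comm_scalar_prod[OF v Cw] by simp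
  have "(t \<cdot>\<^sub>v v - C *\<^sub>v w) \<bullet> (t \<cdot>\<^sub>v v - C *\<^sub>v w)
      = (t \<cdot>\<^sub>v v) \<bullet> (t \<cdot>\<^sub>v v - C *\<^sub>v w) - (C *\<^sub>v w) \<bullet> (t \<cdot>\<^sub>v v - C *\<^sub>v w)"
    using v Cw by (intro minus_scalar_prod_distrib[of _ n]) auto
  also have "(t \<cdot>\<^sub>v v) \<bullet> (t \<cdot>\<^sub>v v - C *\<^sub>v w) = t * (t * (v \<bullet> v)) - t * (w \<bullet> w)"
    using v Cw by (subst scalar_prod_minus_distrib[of _ n]) (auto simp: vCw)
  also have "(C *\<^sub>v w) \<bullet> (t \<cdot>\<^sub>v v - C *\<^sub>v w) = t * (w \<bullet> w) - (C *\<^sub>v w) \<bullet> (C *\<^sub>v w)"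
    using v Cw by (subst scalar_prod_minus_distrib[of _ n]) (auto simp: Cwv)
  finally have "(t \<cdot>\<^sub>v v - C *\<^sub>v w) \<bullet> (t \<cdot>\<^sub>v v - C *\<^sub>v w)
      = t\<^sup>2 * (v \<bullet> v) - 2 * t * (w \<bullet> w) + (C *\<^sub>v w) \<bullet> (C *\<^sub>v w)"
    by (simp add: power2_eq_square)
  moreover have "(C *\<^sub>v w) \<bullet> (C *\<^sub>v w) \<le> w \<bullet> w" using op_boundD[OF C, of w] w by simp
  moreover have "1 * (w \<bullet> w) \<le> 2 * t * (w \<bullet> w)"
    using t by (intro mult_right_mono scalar_prod_self_nonneg) auto
  ultimately show "((t \<cdot>\<^sub>m 1\<^sub>m n - C * C\<^sup>T) *\<^sub>v v) \<bullet> ((t \<cdot>\<^sub>m 1\<^sub>m n - C * C\<^sup>T) *\<^sub>v v) \<le> t\<^sup>2 * (v \<bullet> v)"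
    unfolding eq by simp
qed

lemma op_bound_complement:
  assumes "op_bound 1 C" "dim_row C = n"
  shows "op_bound 1 (1\<^sub>m n - C * C\<^sup>T)"
proof -
  have "(1::real) \<cdot>\<^sub>m 1\<^sub>m n = 1\<^sub>m n" by (rule eq_matI) auto
  then show ?thesis using op_bound_scalar_minus_gram[OF assms, of 1] by simp
qed

lemma mat_diag_mult_vec:
  "v \<in> carrier_vec n \<Longrightarrow> mat_diag n f *\<^sub>v v = vec n (\<lambda>i. f i * v $ i :: 'a :: semiring_0)"
  by (rule eq_vecI) (auto simp: mat_diag_def scalar_prod_def if_distrib[of "\<lambda>x. x * _"] cong: if_cong)

lemma op_bound_mat_diag:
  assumes "\<And>i. i < n \<Longrightarrow> \<bar>f i\<bar> \<le> c" "0 \<le> c"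
  shows "op_bound c (mat_diag n f)"
proof -
  have "(\<Sum>i = 0..<n. f i * v $ i * (f i * v $ i)) \<le> c\<^sup>2 * (v \<bullet> v)"
    if v: "v \<in> carrier_vec n" for v
  proof -
    have "f i * v $ i * (f i * v $ i) \<le> c\<^sup>2 * (v $ i * v $ i)" if "i < n" for i
    proof -
      have "(f i)\<^sup>2 \<le> c\<^sup>2" using assms that by (metis abs_le_square_iff abs_of_nonneg)
      then have "(f i)\<^sup>2 * (v $ i)\<^sup>2 \<le> c\<^sup>2 * (v $ i)\<^sup>2" by (rule mult_right_mono) simp
      then show ?thesis by (simp add: power2_eq_square mult_ac)
    qed
    then have "(\<Sum>i = 0..<n. f i * v $ i * (f i * v $ i)) \<le> (\<Sum>i = 0..<n. c\<^sup>2 * (v $ i * v $ i))"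
      by (intro sum_mono) auto
    also have "\<dots> = c\<^sup>2 * (v \<bullet> v)" using v by (simp add: scalar_prod_def sum_distrib_left)
    finally show ?thesis .
  qed
  then show ?thesis using assms by (auto simp: op_bound_def mat_diag_mult_vec scalar_prod_def)
qed

lemma op_bound_col_sum:
  assumes "op_bound c W" "j < dim_col W"
  shows "(\<Sum>i<dim_row W. (W $$ (i, j))\<^sup>2) \<le> c\<^sup>2"
proof -
  have "W *\<^sub>v unit_vec (dim_col W) j = col W j"
    using assms(2) by (intro eq_vecI) auto
  then have "col W j \<bullet> col W j \<le> c\<^sup>2 * (unit_vec (dim_col W) j \<bullet> unit_vec (dim_col W) j)"
    using op_boundD[OF assms(1), of "unit_vec (dim_col W) j"] by simp
  moreover have "(unit_vec (dim_col W) j \<bullet> unit_vec (dim_col W) j) = (1::real)"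
    using assms(2) by simp
  moreover have "col W j \<bullet> col W j = (\<Sum>i<dim_row W. (W $$ (i, j))\<^sup>2)"
    using assms(2) by (simp add: scalar_prod_def power2_eq_square atLeast0LessThan)
  ultimately show ?thesis by simp
qed

lemma op_bound_row_sum:
  assumes "op_bound c W" "i < dim_row W"
  shows "(\<Sum>j<dim_col W. (W $$ (i, j))\<^sup>2) \<le> c\<^sup>2"
  using op_bound_col_sum[OF op_bound_transpose[OF assms(1)], of i] assms(2) by simp

section \<open>The spectral theorem for real symmetric matrices\<close>

lemma orthogonal_with_first_column:
  fixes v :: "real vec"
  assumes v: "v \<in> carrier_vec n" "v \<bullet> v = 1" and n: "0 < n"
  obtains W where "W \<in> carrier_mat n n" "W\<^sup>T = W" "W * W = 1\<^sub>m n" "W *\<^sub>v unit_vec n 0 = v"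
proof (cases "v = unit_vec n 0")
  case True
  with n show ?thesis by (intro that[of "1\<^sub>m n"]) auto
next
  case False
  \<comment> \<open>The Householder reflection along \<open>v - e\<^sub>0\<close> exchanges \<open>v\<close> and \<open>e\<^sub>0\<close>.\<close>
  define u where "u = (\<lambda>i. v $ i - (if i = 0 then 1 else 0))"
  define s where "s = (\<Sum>i<n. u i * u i)"
  have sv: "(\<Sum>i<n. v $ i * v $ i) = 1"
    using v by (simp add: scalar_prod_def atLeast0LessThan)
  have "s = (\<Sum>i<n. v $ i * v $ i - (if i = 0 then 2 * v $ 0 - 1 else 0))"
    unfolding s_def u_def by (intro sum.cong) (auto simp: algebra_simps)
  also have "\<dots> = 2 - 2 * v $ 0" using n by (simp add: sum_subtractf sv)
  finally have s2: "s = 2 - 2 * v $ 0" .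
  have "s \<noteq> 0"
  proof
    assume "s = 0"
    then have "u i = 0" if "i < n" for i
      using that unfolding s_def by (subst (asm) sum_nonneg_eq_0_iff) auto
    then have "v = unit_vec n 0" using v by (intro eq_vecI) (auto simp: u_def unit_vec_def)
    with False show False by simp
  qed
  \<comment> \<open>With \<open>c * s = 2\<close> the terms of \<open>W * W\<close> beyond the
    identity cancel, so \<open>W\<close> is an involution.\<close>
  define c where "c = 2 / s"
  have cs: "c * s = 2" using \<open>s \<noteq> 0\<close> by (simp add: c_def)
  define W where "W = mat n n (\<lambda>(i, j). (if i = j then 1 else 0) - c * u i * u j)"
  show ?thesis
  proof (rule that[of W])
    show "W \<in> carrier_mat n n" by (simp add: W_def)
    show "W\<^sup>T = W" by (rule eq_matI) (auto simp: W_def)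
    show "W * W = 1\<^sub>m n"
    proof (rule eq_matI)
      fix i j assume "i < dim_row (1\<^sub>m n :: real mat)" "j < dim_col (1\<^sub>m n :: real mat)"
      then have ij: "i < n" "j < n" by auto
      have "(W * W) $$ (i, j) = (\<Sum>k<n. ((if i = k then 1 else 0) - c * u i * u k) *
          ((if k = j then 1 else 0) - c * u k * u j))"
        using ij by (simp add: W_def scalar_prod_def atLeast0LessThan)
      also have "\<dots> = (\<Sum>k<n. ((if k = i then (if i = j then 1 else 0) - c * u i * u j else 0)
           - (if k = j then c * u i * u j else 0)) + c * c * u i * u j * (u k * u k))"
        by (intro sum.cong) (auto simp: algebra_simps)
      also have "\<dots> = (if i = j then 1 else 0) - 2 * (c * u i * u j) + c * (c * s) * u i * u j"
        using ij by (simp add: sum.distrib sum_subtractf sum_distrib_left[symmetric] s_def[symmetric])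
      also have "\<dots> = 1\<^sub>m n $$ (i, j)" using ij by (simp add: cs)
      finally show "(W * W) $$ (i, j) = 1\<^sub>m n $$ (i, j)" .
    qed (auto simp: W_def)
    \<comment> \<open>Here \<open>u 0 = v $ 0 - 1 = - s / 2\<close>, so column 0 of \<open>W\<close>
      is the first unit vector plus \<open>u\<close>, which is \<open>v\<close>.\<close>
    have "c * u 0 = -1" using \<open>s \<noteq> 0\<close> unfolding c_def s2 u_def by (simp add: field_simps)
    then have cu: "c * u i * u 0 = - u i" for i by (metis mult.commute mult.left_commute mult_minus1)
    show "W *\<^sub>v unit_vec n 0 = v"
    proof (rule eq_vecI)
      fix i assume "i < dim_vec v"
      with v have i: "i < n" by auto
      then show "(W *\<^sub>v unit_vec n 0) $ i = v $ i"
        using n by (simp add: W_def cu) (simp add: u_def)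
    qed (use v in \<open>auto simp: W_def\<close>)
  qed
qed

text \<open>The fundamental theorem of algebra supplies a complex eigenvalue \<open>z\<close> with
  eigenvector \<open>v\<close>. It is real because the quadratic form \<open>S\<close> of
  \<open>v\<close> is real by symmetry and equals \<open>z * T\<close>, where \<open>T\<close> is
  the squared length of \<open>v\<close>, real and nonzero.\<close>

lemma symmetric_real_eigenvalue:
  fixes A :: "real mat"
  assumes A: "A \<in> carrier_mat n n" and sym: "A\<^sup>T = A" and n: "0 < n"
  shows "\<exists>e. eigenvalue A e"
proof -
  define C where "C = map_mat complex_of_real A"
  have C: "C \<in> carrier_mat n n" using A by (simp add: C_def)
  have cp: "char_poly C = map_poly complex_of_real (char_poly A)"
    unfolding C_def by (rule of_real_hom.char_poly_hom[OF A])
  have "degree (char_poly C) = n" using degree_monic_char_poly[OF C] by simp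
  then have "\<not> constant (poly (char_poly C))" using n by (simp add: constant_degree)
  then obtain z where z: "poly (char_poly C) z = 0"
    using fundamental_theorem_of_algebra by blast
  then have "eigenvalue C z" by (simp add: eigenvalue_root_char_poly[OF C])
  then obtain v where v: "v \<in> carrier_vec n" "v \<noteq> 0\<^sub>v n" "C *\<^sub>v v = z \<cdot>\<^sub>v v"
    using C unfolding eigenvalue_def eigenvector_def by auto
  define T where "T = (\<Sum>i<n. v $ i * cnj (v $ i))"
  define S where "S = (\<Sum>i<n. \<Sum>j<n. of_real (A $$ (i, j)) * v $ j * cnj (v $ i))"
  have row: "(\<Sum>j<n. of_real (A $$ (i, j)) * v $ j) = z * v $ i" if "i < n" for i
  proof -
    have "(C *\<^sub>v v) $ i = (\<Sum>j<n. of_real (A $$ (i, j)) * v $ j)"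
      using that A v(1) by (simp add: C_def scalar_prod_def atLeast0LessThan)
    then show ?thesis using that v by simp
  qed
  have "S = (\<Sum>i<n. z * v $ i * cnj (v $ i))"
    unfolding S_def by (intro sum.cong) (auto simp: sum_distrib_right[symmetric] row)
  then have S1: "S = z * T" by (simp add: T_def sum_distrib_left mult.assoc)
  have Asym: "A $$ (i, j) = A $$ (j, i)" if "i < n" "j < n" for i j
    using that A sym by (metis carrier_matD index_transpose_mat(1))
  have "cnj S = (\<Sum>i<n. \<Sum>j<n. of_real (A $$ (i, j)) * cnj (v $ j) * v $ i)"
    by (simp add: S_def)
  also have "\<dots> = (\<Sum>j<n. \<Sum>i<n. of_real (A $$ (i, j)) * cnj (v $ j) * v $ i)"
    by (rule sum.swap)
  also have "\<dots> = S" unfolding S_def by (intro sum.cong refl) (simp add: Asym mult_ac)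
  finally have S2: "cnj S = S" .
  have Tr: "T = of_real (\<Sum>i<n. (cmod (v $ i))\<^sup>2)"
    unfolding T_def of_real_sum by (intro sum.cong refl complex_norm_square[symmetric])
  have "T \<noteq> 0"
  proof
    assume "T = 0"
    then have "(\<Sum>i<n. (cmod (v $ i))\<^sup>2) = 0" unfolding Tr by (simp only: of_real_eq_0_iff)
    then have "v $ i = 0" if "i < n" for i
      using that by (subst (asm) sum_nonneg_eq_0_iff) auto
    then have "v = 0\<^sub>v n" using v(1) by (intro eq_vecI) auto
    with v show False by simp
  qed
  moreover have "cnj T = T" unfolding Tr by simp
  ultimately have "cnj z = z" using S1 S2 by (metis complex_cnj_mult mult_right_cancel)
  then obtain a where a: "z = of_real a" by (metis Reals_cases Reals_cnj_iff)
  have "of_real (poly (char_poly A) a) = (0 :: complex)" using z unfolding cp a by simp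
  then have "poly (char_poly A) a = 0" by simp
  then show ?thesis using eigenvalue_root_char_poly[OF A] by blast
qed

lemma eigenvalue_of_diagonalization:
  fixes V :: "real mat"
  assumes V: "V \<in> carrier_mat n n" "V\<^sup>T * V = 1\<^sub>m n" and A: "A = V * mat_diag n f * V\<^sup>T" and i: "i < n"
  shows "eigenvalue A (f i)"
proof -
  let ?v = "V *\<^sub>v unit_vec n i"
  have uv: "V\<^sup>T *\<^sub>v ?v = unit_vec n i"
    using V by (subst assoc_mult_mat_vec[symmetric, of _ n n _ n]) auto
  have "A *\<^sub>v ?v = V * mat_diag n f *\<^sub>v (V\<^sup>T *\<^sub>v ?v)"
    unfolding A using V by (intro assoc_mult_mat_vec[of _ n n _ n]) auto
  also have "\<dots> = V *\<^sub>v (mat_diag n f *\<^sub>v unit_vec n i)"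
    unfolding uv using V by (intro assoc_mult_mat_vec[of _ n n _ n]) auto
  also have "mat_diag n f *\<^sub>v unit_vec n i = f i \<cdot>\<^sub>v unit_vec n i"
    using i by (subst mat_diag_mult_vec) (auto intro!: eq_vecI simp: unit_vec_def)
  also have "V *\<^sub>v (f i \<cdot>\<^sub>v unit_vec n i) = f i \<cdot>\<^sub>v ?v" using V by (intro mult_mat_vec) auto
  finally have ev: "A *\<^sub>v ?v = f i \<cdot>\<^sub>v ?v" .
  have "?v \<noteq> 0\<^sub>v n"
  proof
    assume "?v = 0\<^sub>v n"
    then have "unit_vec n i = V\<^sup>T *\<^sub>v 0\<^sub>v n" using uv by simp
    also have "\<dots> = 0\<^sub>v n" using V by auto
    finally show False using i by (metis index_unit_vec(2) index_zero_vec(1) zero_neq_one)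
  qed
  then show ?thesis
    unfolding eigenvalue_def eigenvector_def
    using ev V by (intro exI[of _ ?v]) (auto simp: A)
qed

text \<open>Induction by deflation: a symmetric orthogonal \<open>W\<close> carries the unit
  eigenvector of the largest eigenvalue \<open>e\<close> to the first unit vector, so
  \<open>W * A * W\<close> splits into the entry \<open>e\<close> and a smaller symmetric
  block.\<close>

theorem spectral_decomposition:
  fixes A :: "real mat"
  assumes "A \<in> carrier_mat n n" "A\<^sup>T = A"
  shows "\<exists>V f. V \<in> carrier_mat n n \<and> V\<^sup>T * V = 1\<^sub>m n \<and> A = V * mat_diag n f * V\<^sup>T \<and>
    (\<forall>i j. i \<le> j \<longrightarrow> j < n \<longrightarrow> f j \<le> f i)"
  using assms
proof (induction n arbitrary: A)
  case 0
  show ?case by (rule exI[of _ "1\<^sub>m 0"], rule exI) (use 0 in \<open>auto intro!: eq_matI\<close>)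
next
  case (Suc n A)
  define E where "E = {e. eigenvalue A e}"
  have "char_poly A \<noteq> 0" using degree_monic_char_poly[OF Suc.prems(1)] by auto
  then have finE: "finite E"
    using poly_roots_finite by (simp add: E_def eigenvalue_root_char_poly[OF Suc.prems(1)])
  have neE: "E \<noteq> {}" using symmetric_real_eigenvalue[OF Suc.prems] by (auto simp: E_def)
  define e where "e = Max E"
  have "e \<in> E" unfolding e_def using finE neE by (rule Max_in)
  then obtain v0 where v0: "v0 \<in> carrier_vec (Suc n)" "v0 \<noteq> 0\<^sub>v (Suc n)" "A *\<^sub>v v0 = e \<cdot>\<^sub>v v0"
    using Suc.prems unfolding E_def eigenvalue_def eigenvector_def by auto
  have v0p: "v0 \<bullet> v0 > 0"
  proof -
    have "v0 \<bullet> v0 \<noteq> 0"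
    proof
      assume "v0 \<bullet> v0 = 0"
      then have "v0 $ i = 0" if "i < Suc n" for i
        using that v0(1) unfolding scalar_prod_def by (subst (asm) sum_nonneg_eq_0_iff) auto
      then have "v0 = 0\<^sub>v (Suc n)" using v0(1) by (intro eq_vecI) auto
      with v0 show False by simp
    qed
    then show ?thesis using scalar_prod_self_nonneg[of v0] by simp
  qed
  define v where "v = (1 / sqrt (v0 \<bullet> v0)) \<cdot>\<^sub>v v0"
  have v: "v \<in> carrier_vec (Suc n)" using v0 by (simp add: v_def)
  have vv: "v \<bullet> v = 1" using v0 v0p by (simp add: v_def)
  have Av: "A *\<^sub>v v = e \<cdot>\<^sub>v v"
    unfolding v_def using v0 Suc.prems
    by (subst mult_mat_vec[of _ "Suc n" "Suc n"]) (auto simp: smult_smult_assoc mult.commute)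
  obtain W where W: "W \<in> carrier_mat (Suc n) (Suc n)" "W\<^sup>T = W" "W * W = 1\<^sub>m (Suc n)"
      "W *\<^sub>v unit_vec (Suc n) 0 = v"
    using orthogonal_with_first_column[OF v vv] by blast
  have dims: "dim_row W = Suc n" "dim_col W = Suc n" "dim_row A = Suc n" "dim_col A = Suc n"
    using W Suc.prems by auto
  define B where "B = W * A * W"
  have B: "B \<in> carrier_mat (Suc n) (Suc n)" using W Suc.prems by (simp add: B_def)
  have Bsym: "B\<^sup>T = B"
    unfolding B_def using W Suc.prems by (simp add: mat_transposes mat_assoc dims)
  have WBW: "A = W * B * W"
  proof -
    have "W * B * W = (W * W) * A * (W * W)"
      unfolding B_def by (simp only: mat_assoc dims index_mult_mat)
    then show ?thesis using W Suc.prems by (simp add: mat_one_mult)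
  qed
  have "B *\<^sub>v unit_vec (Suc n) 0 = W * A *\<^sub>v v"
    unfolding B_def using W Suc.prems by (subst assoc_mult_mat_vec[of _ "Suc n" "Suc n" _ "Suc n"]) auto
  also have "\<dots> = W *\<^sub>v (e \<cdot>\<^sub>v v)"
    using W Suc.prems v Av by (subst assoc_mult_mat_vec[of _ "Suc n" "Suc n" _ "Suc n"]) auto
  also have "\<dots> = e \<cdot>\<^sub>v (W *\<^sub>v v)" using W v by (intro mult_mat_vec) auto
  also have "W *\<^sub>v v = W * W *\<^sub>v unit_vec (Suc n) 0"
    unfolding W(4)[symmetric] using W(1) by (subst assoc_mult_mat_vec[of _ "Suc n" "Suc n" _ "Suc n"]) auto
  also have "\<dots> = unit_vec (Suc n) 0" by (simp add: W(3))
  finally have Be: "B *\<^sub>v unit_vec (Suc n) 0 = e \<cdot>\<^sub>v unit_vec (Suc n) 0" .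
  have "col B 0 = B *\<^sub>v unit_vec (Suc n) 0" using B by (intro eq_vecI) auto
  note Bcol = this[unfolded Be]
  have B0: "B $$ (i, 0) = (if i = 0 then e else 0)" if "i < Suc n" for i
    using arg_cong[OF Bcol, of "\<lambda>x. x $ i"] that B by (auto simp: unit_vec_def)
  have B0': "B $$ (0, i) = (if i = 0 then e else 0)" if "i < Suc n" for i
    using B0[OF that] that B Bsym by (metis carrier_matD index_transpose_mat(1) zero_less_Suc)
  define B3 where "B3 = mat n n (\<lambda>(i, j). B $$ (Suc i, Suc j))"
  have B3: "B3 \<in> carrier_mat n n" by (simp add: B3_def)
  have B3sym: "B3\<^sup>T = B3"
  proof (rule eq_matI)
    fix i j assume "i < dim_row B3" "j < dim_col B3"
    then have "i < n" "j < n" by (auto simp: B3_def)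
    then show "B3\<^sup>T $$ (i, j) = B3 $$ (i, j)"
      using B Bsym by (simp add: B3_def) (metis Suc_less_eq carrier_matD index_transpose_mat(1))
  qed (auto simp: B3_def)
  obtain V3 f3 where IH: "V3 \<in> carrier_mat n n" "V3\<^sup>T * V3 = 1\<^sub>m n" "B3 = V3 * mat_diag n f3 * V3\<^sup>T"
      "\<And>i j. i \<le> j \<Longrightarrow> j < n \<Longrightarrow> f3 j \<le> f3 i"
    using Suc.IH[OF B3 B3sym] by blast
  define Q where "Q = four_block_mat (1\<^sub>m 1) (0\<^sub>m 1 n) (0\<^sub>m n 1) V3"
  have Q: "Q \<in> carrier_mat (Suc n) (Suc n)" unfolding Q_def using IH(1) by (metis four_block_carrier_mat one_carrier_mat plus_1_eq_Suc)
  define f where "f = (\<lambda>i. case i of 0 \<Rightarrow> e | Suc j \<Rightarrow> f3 j)"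
  have D: "mat_diag (Suc n) f = four_block_mat (mat_diag 1 (\<lambda>_. e)) (0\<^sub>m 1 n) (0\<^sub>m n 1) (mat_diag n f3)"
    by (rule eq_matI) (auto simp: mat_diag_def f_def split: nat.splits)
  have QT: "Q\<^sup>T = four_block_mat (1\<^sub>m 1) (0\<^sub>m 1 n) (0\<^sub>m n 1) V3\<^sup>T"
    unfolding Q_def using IH(1) by (subst transpose_four_block_mat[of _ 1 1 _ n _ n]) auto
  have QQ: "Q\<^sup>T * Q = 1\<^sub>m (Suc n)"
    unfolding QT unfolding Q_def using IH(1,2)
    by (subst mult_four_block_mat[of _ 1 1 _ n _ n _ _ 1 _ n]) auto
  have B_block: "B = four_block_mat (mat_diag 1 (\<lambda>_. e)) (0\<^sub>m 1 n) (0\<^sub>m n 1) B3"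
    by (rule eq_matI) (use B B0 B0' in \<open>auto simp: mat_diag_def B3_def\<close>)
  have BQ: "B = Q * mat_diag (Suc n) f * Q\<^sup>T"
  proof -
    have "Q * mat_diag (Suc n) f = four_block_mat (mat_diag 1 (\<lambda>_. e)) (0\<^sub>m 1 n) (0\<^sub>m n 1) (V3 * mat_diag n f3)"
      unfolding Q_def D using IH(1)
      by (subst mult_four_block_mat[of _ 1 1 _ n _ n _ _ 1 _ n]) (auto simp del: One_nat_def)
    also have "\<dots> * Q\<^sup>T = B"
      unfolding QT B_block IH(3) using IH(1)
      by (subst mult_four_block_mat[of _ 1 1 _ n _ n _ _ 1 _ n]) (auto simp del: One_nat_def)
    finally show ?thesis ..
  qed
  define V where "V = W * Q"
  have dQ: "dim_row Q = Suc n" "dim_col Q = Suc n" using Q by auto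
  have V: "V \<in> carrier_mat (Suc n) (Suc n)" using W Q by (simp add: V_def)
  have VV: "V\<^sup>T * V = 1\<^sub>m (Suc n)"
  proof -
    have "V\<^sup>T * V = Q\<^sup>T * ((W * W) * Q)"
      unfolding V_def by (simp add: mat_transposes dims dQ W(2) mat_assoc del: assoc_mult_mat)
    then show ?thesis by (simp add: W(3) QQ mat_one_mult dQ)
  qed
  have AV: "A = V * mat_diag (Suc n) f * V\<^sup>T"
    by (subst WBW, subst BQ) (simp add: V_def mat_transposes dims dQ W(2) mat_assoc del: assoc_mult_mat)
  have "f j \<le> f i" if "i \<le> j" "j < Suc n" for i j
  proof (cases i)
    case 0
    \<comment> \<open>Every diagonal entry is an eigenvalue of \<open>A\<close>, hence at most the
      maximum \<open>e\<close>; so \<open>e\<close> rightly stands first in the decreasing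
      order.\<close>
    have "f j \<in> E" unfolding E_def using eigenvalue_of_diagonalization[OF V VV AV that(2)] by simp
    then show ?thesis using finE 0 by (simp add: f_def e_def)
  next
    case (Suc i')
    then show ?thesis using that IH(4) by (cases j) (auto simp: f_def)
  qed
  then show ?case using V VV AV by blast
qed

section \<open>Singular values and Ky Fan sums\<close>

lemma rev_sort_decreasing:
  fixes xs :: "'a :: linorder list"
  assumes "\<And>i j. i \<le> j \<Longrightarrow> j < length xs \<Longrightarrow> xs ! j \<le> xs ! i"
  shows "rev (sort xs) = xs"
proof -
  have "sorted (rev xs)"
    unfolding sorted_iff_nth_mono by (auto simp: rev_nth intro!: assms)
  then have "sort xs = rev xs" by (intro properties_for_sort) auto
  then show ?thesis by simp
qed

text \<open>Similarity turns the characteristic polynomial of \<open>A\<^sup>T * A\<close> into the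
  product of the factors x - f i, so its roots with multiplicity are the values of \<open>f\<close>,
  and these are already in decreasing order.\<close>

lemma singular_values_of_gram:
  assumes V: "V \<in> carrier_mat m m" "V\<^sup>T * V = 1\<^sub>m m"
    and A: "A\<^sup>T * A = V * mat_diag m f * V\<^sup>T"
    and dec: "\<And>i j. i \<le> j \<Longrightarrow> j < m \<Longrightarrow> f j \<le> f i"
  shows "singular_values A = map (\<lambda>i. sqrt (f i)) [0..<m]"
proof -
  let ?D = "mat_diag m f"
  have VV: "V * V\<^sup>T = 1\<^sub>m m" using V by (intro mat_mult_left_right_inverse[of "V\<^sup>T" m V]) simp_all
  have "similar_mat (A\<^sup>T * A) ?D"
    by (rule similar_matI[of _ _ V "V\<^sup>T" m]) (use V VV A in auto)
  then have "char_poly (A\<^sup>T * A) = char_poly ?D" by (rule char_poly_similar)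
  also have "\<dots> = (\<Prod>a\<leftarrow>diag_mat ?D. [:- a, 1:])"
    by (rule char_poly_upper_triangular[of _ m]) (auto simp: mat_diag_def)
  also have "diag_mat ?D = map f [0..<m]" by (auto simp: diag_mat_def mat_diag_def)
  finally have cp: "char_poly (A\<^sup>T * A) = (\<Prod>a\<leftarrow>map f [0..<m]. [:- a, 1:])" .
  have roots: "proots (\<Prod>a\<leftarrow>xs. [:- a, 1:]) = mset xs" for xs :: "real list"
  proof (induction xs)
    case (Cons a xs)
    have "(\<Prod>a\<leftarrow>xs. [:- a, 1:]) \<noteq> 0" by (auto simp: prod_list_zero_iff simp del: mult_pCons_left)
    then show ?case using Cons.IH by (simp add: proots_mult del: mult_pCons_left)
  qed simp
  have "singular_values A = rev (sort (map (\<lambda>i. sqrt (f i)) [0..<m]))"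
    unfolding singular_values_def cp roots
    by (simp add: mset_map[symmetric] o_def del: mset_map)
  also have "\<dots> = map (\<lambda>i. sqrt (f i)) [0..<m]"
    by (rule rev_sort_decreasing) (auto intro: dec)
  finally show ?thesis .
qed

text \<open>The columns of the left factor belonging to the singular value \<open>0\<close> are zero, so that no
  orthonormal basis has to be completed.\<close>

lemma singular_value_decomposition:
  fixes A :: "real mat"
  assumes A: "A \<in> carrier_mat p m"
  defines "\<sigma> \<equiv> singular_value_seq A"
  obtains U V where "U \<in> carrier_mat p m" "V \<in> carrier_mat m m" "op_bound 1 U" "op_bound 1 V"
    "V\<^sup>T * V = 1\<^sub>m m" "A = U * mat_diag m \<sigma> * V\<^sup>T"
    "\<And>i j. i < m \<Longrightarrow> j < m \<Longrightarrow> \<sigma> j * (U\<^sup>T * U) $$ (i, j) = (if i = j then \<sigma> j else 0)"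
    "\<And>i. 0 \<le> \<sigma> i" "\<And>i. m \<le> i \<Longrightarrow> \<sigma> i = 0" "\<And>i j. i \<le> j \<Longrightarrow> \<sigma> j \<le> \<sigma> i"
proof -
  have G: "A\<^sup>T * A \<in> carrier_mat m m" "(A\<^sup>T * A)\<^sup>T = A\<^sup>T * A"
    using A by (auto simp: mat_transposes)
  from spectral_decomposition[OF G] obtain V f where
    V: "V \<in> carrier_mat m m" "V\<^sup>T * V = 1\<^sub>m m" and AA: "A\<^sup>T * A = V * mat_diag m f * V\<^sup>T" and
    dec: "\<And>i j. i \<le> j \<Longrightarrow> j < m \<Longrightarrow> f j \<le> f i" by blast
  have VV: "V * V\<^sup>T = 1\<^sub>m m" using V by (intro mat_mult_left_right_inverse[of "V\<^sup>T" m V]) simp_all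
  have dims: "dim_row A = p" "dim_col A = m" "dim_row V = m" "dim_col V = m" using A V by auto
  have sv: "singular_values A = map (\<lambda>i. sqrt (f i)) [0..<m]"
    by (rule singular_values_of_gram[OF V AA dec])
  have \<sigma>: "\<sigma> i = (if i < m then sqrt (f i) else 0)" for i
    by (simp add: \<sigma>_def singular_value_seq_def sv)
  define C where "C = A * V"
  have C: "C \<in> carrier_mat p m" using A V by (simp add: C_def)
  have CC: "C\<^sup>T * C = mat_diag m f"
  proof -
    have "C\<^sup>T * C = (V\<^sup>T * (A\<^sup>T * A)) * V"
      unfolding C_def by (simp add: mat_transposes mat_assoc dims del: assoc_mult_mat)
    also have "\<dots> = (V\<^sup>T * V) * mat_diag m f * (V\<^sup>T * V)"
      unfolding AA by (simp add: mat_assoc dims del: assoc_mult_mat)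
    finally show ?thesis by (simp add: V mat_one_mult)
  qed
  have CCij: "(\<Sum>k<p. C $$ (k, i) * C $$ (k, j)) = (if i = j then f j else 0)" if "i < m" "j < m" for i j
    using arg_cong[OF CC, of "\<lambda>M. M $$ (i, j)"] that C
    by (auto simp: scalar_prod_def mat_diag_def atLeast0LessThan)
  have f0: "0 \<le> f i" if "i < m" for i
    using CCij[OF that that] sum_nonneg[of "{..<p}" "\<lambda>k. C $$ (k, i) * C $$ (k, i)"] by simp
  \<comment> \<open>Column \<open>i\<close> of \<open>C\<close> has squared length
    \<open>f i\<close>, so it vanishes together with \<open>f i\<close>.\<close>
  have C0: "C $$ (k, i) = 0" if "f i = 0" "i < m" "k < p" for k i
  proof -
    have "(\<Sum>k<p. C $$ (k, i) * C $$ (k, i)) = 0" using CCij[OF that(2) that(2)] that(1) by simp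
    then have "\<forall>k\<in>{..<p}. C $$ (k, i) * C $$ (k, i) = 0"
      by (subst (asm) sum_nonneg_eq_0_iff) auto
    with that show ?thesis by simp
  qed
  have \<sigma>f: "\<sigma> i * \<sigma> i = f i" if "i < m" for i using that f0 by (simp add: \<sigma>)
  \<comment> \<open>For \<open>\<sigma> i = 0\<close> the convention \<open>inverse 0 = 0\<close>
    yields a zero column, and \<open>UC\<close> still holds there because of
    \<open>C0\<close>.\<close>
  define U where "U = C * mat_diag m (\<lambda>i. inverse (\<sigma> i))"
  have U: "U \<in> carrier_mat p m" using C by (simp add: U_def)
  have Uij: "U $$ (k, i) = C $$ (k, i) * inverse (\<sigma> i)" if "k < p" "i < m" for k i
    unfolding U_def using that C by (subst mat_diag_mult_right[of _ p m]) auto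
  have UC: "U * mat_diag m \<sigma> = C"
  proof (rule eq_matI)
    fix k i assume "k < dim_row C" "i < dim_col C"
    then have ki: "k < p" "i < m" using C by auto
    have "(U * mat_diag m \<sigma>) $$ (k, i) = C $$ (k, i) * inverse (\<sigma> i) * \<sigma> i"
      using ki U by (subst mat_diag_mult_right[of _ p m]) (auto simp: Uij)
    also have "\<dots> = C $$ (k, i)" using \<sigma>f[of i] C0[of i k] ki by (cases "\<sigma> i = 0") auto
    finally show "(U * mat_diag m \<sigma>) $$ (k, i) = C $$ (k, i)" .
  qed (use U C in auto)
  have UU: "(U\<^sup>T * U) $$ (i, j) = (if i = j \<and> \<sigma> i \<noteq> 0 then 1 else 0)" if "i < m" "j < m" for i j
  proof -
    have "(U\<^sup>T * U) $$ (i, j) = (\<Sum>k<p. U $$ (k, i) * U $$ (k, j))"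
      using that U by (simp add: scalar_prod_def atLeast0LessThan)
    also have "\<dots> = (\<Sum>k<p. (C $$ (k, i) * C $$ (k, j)) * (inverse (\<sigma> i) * inverse (\<sigma> j)))"
      using that by (intro sum.cong) (auto simp: Uij)
    also have "\<dots> = (if i = j then f j else 0) * (inverse (\<sigma> i) * inverse (\<sigma> j))"
      by (simp only: sum_distrib_right[symmetric] CCij[OF that])
    finally show ?thesis using that \<sigma>f[of j] by (auto simp: field_simps)
  qed
  have "op_bound 1 U"
  proof -
    have "(U *\<^sub>v v) \<bullet> (U *\<^sub>v v) \<le> v \<bullet> v" if v: "v \<in> carrier_vec m" for v
    proof -
      have UUd: "U\<^sup>T * U = mat_diag m (\<lambda>i. if \<sigma> i \<noteq> 0 then 1 else 0)"
        by (rule eq_matI) (use UU U in \<open>auto simp: mat_diag_def\<close>)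
      have "(U *\<^sub>v v) \<bullet> (U *\<^sub>v v) = v \<bullet> (U\<^sup>T *\<^sub>v (U *\<^sub>v v))"
        using v U by (intro scalar_prod_mult_mat_vec) auto
      also have "U\<^sup>T *\<^sub>v (U *\<^sub>v v) = U\<^sup>T * U *\<^sub>v v"
        using v U by (intro assoc_mult_mat_vec[symmetric, of _ m p _ m]) auto
      also have "v \<bullet> (U\<^sup>T * U *\<^sub>v v) = (\<Sum>i<m. v $ i * ((if \<sigma> i \<noteq> 0 then 1 else 0) * v $ i))"
        unfolding UUd using v by (simp add: mat_diag_mult_vec scalar_prod_def atLeast0LessThan)
      also have "\<dots> \<le> (\<Sum>i<m. v $ i * v $ i)" by (intro sum_mono) auto
      also have "\<dots> = v \<bullet> v" using v by (simp add: scalar_prod_def atLeast0LessThan)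
      finally show ?thesis .
    qed
    then show ?thesis using U by (auto simp: op_bound_def)
  qed
  moreover have "op_bound 1 V" using V by (intro op_bound_orthonormal) auto
  moreover have "A = U * mat_diag m \<sigma> * V\<^sup>T"
  proof -
    have "U * mat_diag m \<sigma> * V\<^sup>T = A * (V * V\<^sup>T)"
      unfolding UC C_def by (simp add: mat_assoc dims del: assoc_mult_mat)
    then show ?thesis by (simp add: VV mat_one_mult dims)
  qed
  moreover have "\<sigma> j * (U\<^sup>T * U) $$ (i, j) = (if i = j then \<sigma> j else 0)" if "i < m" "j < m" for i j
    using UU[OF that] by auto
  moreover have "0 \<le> \<sigma> i" for i using f0 by (simp add: \<sigma>)
  moreover have "\<sigma> j \<le> \<sigma> i" if "i \<le> j" for i j
    using that dec[of i j] f0[of i] by (simp add: \<sigma>)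
  ultimately show ?thesis using that[of U V] U V \<sigma> by simp
qed

section \<open>The singular value sequence and Ky Fan's maximum principle\<close>

lemma singular_value_seq_nonneg: "0 \<le> singular_value_seq A i"
  by (rule singular_value_decomposition[of A "dim_row A" "dim_col A"]) auto

lemma singular_value_seq_decreasing: "i \<le> j \<Longrightarrow> singular_value_seq A j \<le> singular_value_seq A i"
  by (rule singular_value_decomposition[of A "dim_row A" "dim_col A"]) auto

lemma singular_value_seq_eq_0: "dim_col A \<le> i \<Longrightarrow> singular_value_seq A i = 0"
  by (rule singular_value_decomposition[of A "dim_row A" "dim_col A"]) auto

lemma finitely_supported_singular_value_seq: "finitely_supported (singular_value_seq A)"
  unfolding finitely_supported_def
  by (rule finite_subset[of _ "{..<dim_col A}"]) (auto intro: ccontr simp: singular_value_seq_eq_0 not_less)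

text \<open>After subtracting the level \<open>\<sigma> k\<close>, the term
  \<open>(\<sigma> i - \<sigma> k) * w i\<close> is at most \<open>\<sigma> i - \<sigma> k\<close>
  for \<open>i < k\<close> and at most 0 afterwards; the level itself contributes at most
  \<open>\<sigma> k * real k\<close>.\<close>

lemma sum_weighted_le:
  fixes \<sigma> w :: "nat \<Rightarrow> real"
  assumes \<sigma>: "\<And>i. 0 \<le> \<sigma> i" "\<And>i j. i \<le> j \<Longrightarrow> \<sigma> j \<le> \<sigma> i" "\<And>i. m \<le> i \<Longrightarrow> \<sigma> i = 0"
    and w: "\<And>i. i < m \<Longrightarrow> 0 \<le> w i" "\<And>i. i < m \<Longrightarrow> w i \<le> 1" "(\<Sum>i<m. w i) \<le> real k"
  shows "(\<Sum>i<m. \<sigma> i * w i) \<le> (\<Sum>i<k. \<sigma> i)"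
proof -
  have eq: "(\<Sum>i<m. if i < k then \<sigma> i - \<sigma> k else 0) = (\<Sum>i<k. \<sigma> i - \<sigma> k)"
  proof (cases "k \<le> m")
    case True
    then have "{..<m} \<inter> {i. i < k} = {..<k}" by auto
    then show ?thesis by (simp add: sum.inter_restrict[symmetric] flip: sum.inter_filter)
        (auto intro!: sum.cong simp: Int_def)
  next
    case False
    \<comment> \<open>The additional terms have \<open>m \<le> i < k\<close>, where both
      \<open>\<sigma> i\<close> and \<open>\<sigma> k\<close> are padding zeros.\<close>
    have "(\<Sum>i<k. \<sigma> i - \<sigma> k) = (\<Sum>i<m. \<sigma> i - \<sigma> k)"
      by (rule sum.mono_neutral_right) (use False \<sigma>(3) in auto)
    then show ?thesis using False by simp
  qed
  have "(\<Sum>i<m. (\<sigma> i - \<sigma> k) * w i) \<le> (\<Sum>i<m. if i < k then \<sigma> i - \<sigma> k else 0)"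
  proof (rule sum_mono)
    fix i assume "i \<in> {..<m}"
    then have i: "i < m" by simp
    show "(\<sigma> i - \<sigma> k) * w i \<le> (if i < k then \<sigma> i - \<sigma> k else 0)"
    proof (cases "i < k")
      case True
      then have "0 \<le> \<sigma> i - \<sigma> k" using \<sigma>(2)[of i k] by simp
      then show ?thesis using True mult_left_mono[OF w(2)[OF i]] by fastforce
    next
      case False
      then show ?thesis using \<sigma>(2)[of k i] w(1)[OF i] by (simp add: mult_nonpos_nonneg)
    qed
  qed
  then have "(\<Sum>i<m. \<sigma> i * w i) - \<sigma> k * (\<Sum>i<m. w i) \<le> (\<Sum>i<k. \<sigma> i) - real k * \<sigma> k"
    unfolding eq by (simp add: left_diff_distrib sum_subtractf sum_distrib_left)
  moreover have "\<sigma> k * (\<Sum>i<m. w i) \<le> \<sigma> k * real k" by (intro mult_left_mono w \<sigma>)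
  ultimately show ?thesis by (simp add: mult.commute)
qed

text \<open>In singular coordinates the trace is the sum of
  \<open>\<sigma> i * E $$ (i, j) * F $$ (i, j)\<close>, and by AM-GM the total coefficient of
  \<open>\<sigma> i\<close> is at most \<open>w i\<close>. Rows and columns of the contractions
  \<open>E\<close> and \<open>F\<close> have length at most 1, so each weight is at most 1 and all
  weights together at most \<open>k\<close>.\<close>

lemma Ky_Fan_upper:
  fixes A :: "real mat"
  assumes A: "A \<in> carrier_mat p m"
    and U: "U \<in> carrier_mat p k" "op_bound 1 U" and V: "V \<in> carrier_mat m k" "op_bound 1 V"
  shows "(\<Sum>j<k. (U\<^sup>T * A * V) $$ (j, j)) \<le> (\<Sum>i<k. singular_value_seq A i)"
proof -
  define \<sigma> where "\<sigma> = singular_value_seq A"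
  obtain P Q where P: "P \<in> carrier_mat p m" "op_bound 1 P" and Q: "Q \<in> carrier_mat m m" "op_bound 1 Q"
    and eq: "A = P * mat_diag m \<sigma> * Q\<^sup>T"
    unfolding \<sigma>_def by (rule singular_value_decomposition[OF A]) blast
  have dims: "dim_row P = p" "dim_col P = m" "dim_row Q = m" "dim_col Q = m"
    "dim_row U = p" "dim_col U = k" "dim_row V = m" "dim_col V = k" using P Q U V by auto
  define E F where "E = P\<^sup>T * U" and "F = Q\<^sup>T * V"
  have dEF: "dim_row E = m" "dim_col E = k" "dim_row F = m" "dim_col F = k"
    by (auto simp: E_def F_def dims)
  have E: "op_bound 1 E" unfolding E_def
    using op_bound_mult[OF op_bound_transpose[OF P(2)] U(2)] by (simp add: dims)
  have F: "op_bound 1 F" unfolding F_def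
    using op_bound_mult[OF op_bound_transpose[OF Q(2)] V(2)] by (simp add: dims)
  have UAV: "U\<^sup>T * A * V = E\<^sup>T * (mat_diag m \<sigma> * F)"
    unfolding eq E_def F_def by (simp add: mat_assoc mat_transposes dims del: assoc_mult_mat)
  define w where "w = (\<lambda>i. ((\<Sum>j<k. (E $$ (i, j))\<^sup>2) + (\<Sum>j<k. (F $$ (i, j))\<^sup>2)) / 2)"
  have "(U\<^sup>T * A * V) $$ (j, j) \<le> (\<Sum>i<m. \<sigma> i * (((E $$ (i, j))\<^sup>2 + (F $$ (i, j))\<^sup>2) / 2))" if "j < k" for j
  proof -
    have "(U\<^sup>T * A * V) $$ (j, j) = (\<Sum>i<m. E $$ (i, j) * (\<sigma> i * F $$ (i, j)))"
      unfolding UAV mat_diag_mult_left[OF carrier_matI[OF dEF(3,4)]]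
      using that dEF by (simp add: scalar_prod_def atLeast0LessThan)
    also have "\<dots> \<le> (\<Sum>i<m. \<sigma> i * (((E $$ (i, j))\<^sup>2 + (F $$ (i, j))\<^sup>2) / 2))"
    proof (rule sum_mono)
      fix i
      have "E $$ (i, j) * F $$ (i, j) \<le> ((E $$ (i, j))\<^sup>2 + (F $$ (i, j))\<^sup>2) / 2"
        using sum_squares_bound[of "E $$ (i, j)" "F $$ (i, j)"] by simp
      then have "\<sigma> i * (E $$ (i, j) * F $$ (i, j)) \<le> \<sigma> i * (((E $$ (i, j))\<^sup>2 + (F $$ (i, j))\<^sup>2) / 2)"
        unfolding \<sigma>_def by (intro mult_left_mono singular_value_seq_nonneg)
      then show "E $$ (i, j) * (\<sigma> i * F $$ (i, j)) \<le> \<sigma> i * (((E $$ (i, j))\<^sup>2 + (F $$ (i, j))\<^sup>2) / 2)"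
        by (simp add: mult.left_commute)
    qed
    finally show ?thesis .
  qed
  then have "(\<Sum>j<k. (U\<^sup>T * A * V) $$ (j, j))
      \<le> (\<Sum>j<k. \<Sum>i<m. \<sigma> i * (((E $$ (i, j))\<^sup>2 + (F $$ (i, j))\<^sup>2) / 2))" by (intro sum_mono) auto
  also have "\<dots> = (\<Sum>i<m. \<sigma> i * w i)"
    by (subst sum.swap) (simp add: w_def sum_distrib_left[symmetric] sum.distrib sum_divide_distrib[symmetric])
  also have "\<dots> \<le> (\<Sum>i<k. \<sigma> i)"
  proof (rule sum_weighted_le)
    fix i assume i: "i < m"
    show "0 \<le> w i" unfolding w_def by (intro divide_nonneg_pos add_nonneg_nonneg sum_nonneg) auto
    show "w i \<le> 1" unfolding w_def
      using op_bound_row_sum[OF E, of i] op_bound_row_sum[OF F, of i] i dEF by simp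
  next
    have "(\<Sum>i<m. w i) = ((\<Sum>j<k. \<Sum>i<m. (E $$ (i, j))\<^sup>2) + (\<Sum>j<k. \<Sum>i<m. (F $$ (i, j))\<^sup>2)) / 2"
      unfolding w_def sum_divide_distrib[symmetric] sum.distrib
      by (simp only: sum.swap[of _ "{..<m}" "{..<k}"])
    moreover have "(\<Sum>j<k. \<Sum>i<m. (E $$ (i, j))\<^sup>2) \<le> (\<Sum>j<k. 1)"
      using op_bound_col_sum[OF E] dEF by (intro sum_mono) auto
    moreover have "(\<Sum>j<k. \<Sum>i<m. (F $$ (i, j))\<^sup>2) \<le> (\<Sum>j<k. 1)"
      using op_bound_col_sum[OF F] dEF by (intro sum_mono) auto
    ultimately show "(\<Sum>i<m. w i) \<le> real k" by simp
  qed (use A in \<open>auto simp: \<sigma>_def intro: singular_value_seq_nonneg singular_value_seq_decreasing singular_value_seq_eq_0\<close>)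
  finally show ?thesis by (simp add: \<sigma>_def)
qed

text \<open>The maximum is reached at the first \<open>k\<close> singular vectors on either side,
  filled up with zero columns if there are fewer than \<open>k\<close>.\<close>

lemma Ky_Fan_attained:
  fixes A :: "real mat"
  assumes A: "A \<in> carrier_mat p m"
  obtains U V where "U \<in> carrier_mat p k" "op_bound 1 U" "V \<in> carrier_mat m k" "op_bound 1 V"
    "(\<Sum>j<k. (U\<^sup>T * A * V) $$ (j, j)) = (\<Sum>i<k. singular_value_seq A i)"
proof -
  define \<sigma> where "\<sigma> = singular_value_seq A"
  obtain P Q where P: "P \<in> carrier_mat p m" "op_bound 1 P" and Q: "Q \<in> carrier_mat m m" "op_bound 1 Q"
      "Q\<^sup>T * Q = 1\<^sub>m m" and eq: "A = P * mat_diag m \<sigma> * Q\<^sup>T"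
    and PP: "\<And>i j. i < m \<Longrightarrow> j < m \<Longrightarrow> \<sigma> j * (P\<^sup>T * P) $$ (i, j) = (if i = j then \<sigma> j else 0)"
    and \<sigma>0: "\<And>i. m \<le> i \<Longrightarrow> \<sigma> i = 0"
    unfolding \<sigma>_def by (rule singular_value_decomposition[OF A]) blast
  have dims: "dim_row P = p" "dim_col P = m" "dim_row Q = m" "dim_col Q = m" using P Q by auto
  \<comment> \<open>\<open>J\<close> selects the first \<open>k\<close> columns and has zero columns
    beyond \<open>m\<close>. It is a contraction for every \<open>k\<close>, whereas orthonormal
    columns would force \<open>k \<le> m\<close>.\<close>
  define J :: "real mat" where "J = mat m k (\<lambda>(i, j). if i = j then 1 else 0)"
  have J: "J \<in> carrier_mat m k" "dim_row J = m" "dim_col J = k" by (auto simp: J_def)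
  have "op_bound 1 J"
  proof -
    have "(\<Sum>i<m. (if i < k then v $ i else 0) * (if i < k then v $ i else 0)) \<le> v \<bullet> v"
      if v: "v \<in> carrier_vec k" for v :: "real vec"
    proof -
      have "(\<Sum>i<m. (if i < k then v $ i else 0) * (if i < k then v $ i else 0))
          = (\<Sum>i\<in>{..<m} \<inter> {..<k}. v $ i * v $ i)"
        by (subst sum.inter_restrict) (auto intro!: sum.cong)
      also have "\<dots> \<le> (\<Sum>i<k. v $ i * v $ i)" by (rule sum_mono2) auto
      finally show ?thesis using v by (simp add: scalar_prod_def atLeast0LessThan)
    qed
    moreover have "J *\<^sub>v v = vec m (\<lambda>i. if i < k then v $ i else 0)" if "v \<in> carrier_vec k" for v
      using that by (intro eq_vecI)
        (auto simp: J_def scalar_prod_def if_distrib[of "\<lambda>x. x * _"] cong: if_cong)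
    ultimately show ?thesis
      by (auto simp: op_bound_def J scalar_prod_def[of "vec _ _"] atLeast0LessThan)
  qed
  note Jb = this
  show ?thesis
  proof (rule that[of "P * J" "Q * J"])
    show "P * J \<in> carrier_mat p k" "Q * J \<in> carrier_mat m k" using P Q J by auto
    show "op_bound 1 (P * J)" "op_bound 1 (Q * J)"
      using op_bound_mult[OF P(2) Jb] op_bound_mult[OF Q(2) Jb] by (auto simp: dims J)
    \<comment> \<open>\<open>P\<close> may have zero columns, so \<open>P\<^sup>T * P\<close> need
      not be the identity, but it acts as one on \<open>mat_diag m \<sigma>\<close>.\<close>
    have PPD: "P\<^sup>T * P * mat_diag m \<sigma> = mat_diag m \<sigma>"
    proof (rule eq_matI)
      fix i j assume "i < dim_row (mat_diag m \<sigma>)" "j < dim_col (mat_diag m \<sigma>)"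
      then have ij: "i < m" "j < m" by auto
      have "P\<^sup>T * P \<in> carrier_mat m m" using P by auto
      then have "(P\<^sup>T * P * mat_diag m \<sigma>) $$ (i, j) = (P\<^sup>T * P) $$ (i, j) * \<sigma> j"
        using ij by (subst mat_diag_mult_right[of _ m m]) auto
      then show "(P\<^sup>T * P * mat_diag m \<sigma>) $$ (i, j) = mat_diag m \<sigma> $$ (i, j)"
        using PP[OF ij] ij by (simp add: mult.commute mat_diag_def)
    qed (use P in auto)
    have "(P * J)\<^sup>T * A * (Q * J) = J\<^sup>T * ((P\<^sup>T * P * mat_diag m \<sigma>) * ((Q\<^sup>T * Q) * J))"
      unfolding eq by (simp add: mat_assoc mat_transposes dims J del: assoc_mult_mat)
    also have "\<dots> = J\<^sup>T * (mat_diag m \<sigma> * J)" by (simp only: PPD Q(3) mat_one_mult J)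
    finally have e: "(P * J)\<^sup>T * A * (Q * J) = J\<^sup>T * (mat_diag m \<sigma> * J)" .
    have "(J\<^sup>T * (mat_diag m \<sigma> * J)) $$ (j, j) = \<sigma> j" if "j < k" for j
    proof -
      have "(J\<^sup>T * (mat_diag m \<sigma> * J)) $$ (j, j) = (\<Sum>i<m. J $$ (i, j) * (\<sigma> i * J $$ (i, j)))"
        unfolding mat_diag_mult_left[OF J(1)] using that J by (simp add: scalar_prod_def atLeast0LessThan)
      also have "\<dots> = (\<Sum>i<m. if i = j then \<sigma> i else 0)"
        using that by (intro sum.cong) (auto simp: J_def)
      also have "\<dots> = \<sigma> j" using \<sigma>0[of j] by simp
      finally show ?thesis .
    qed
    then show "(\<Sum>j<k. ((P * J)\<^sup>T * A * (Q * J)) $$ (j, j)) = (\<Sum>i<k. singular_value_seq A i)"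
      unfolding e \<sigma>_def[symmetric] by simp
  qed
qed

section \<open>Unitarily invariant norms\<close>

lemma mat_diag_const_mult: "dim_row A = n \<Longrightarrow> mat_diag n (\<lambda>_. a :: real) * A = a \<cdot>\<^sub>m A"
  by (subst mat_diag_mult_left[of _ _ "dim_col A"]) auto

lemma op_bound_smult:
  assumes "op_bound c A"
  shows "op_bound (\<bar>a\<bar> * c) (a \<cdot>\<^sub>m A)"
proof -
  have "op_bound (\<bar>a\<bar> * c) (mat_diag (dim_row A) (\<lambda>_. a) * A)"
    by (intro op_bound_mult op_bound_mat_diag assms) auto
  then show ?thesis by (simp add: mat_diag_const_mult)
qed

text \<open>Contractions optimal for \<open>A + B\<close> are admissible for \<open>A\<close> and
  for \<open>B\<close>, and the trace is additive.\<close>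

lemma Ky_Fan_add:
  assumes "dim_row A = dim_row B" "dim_col A = dim_col B"
  shows "(\<Sum>i<k. singular_value_seq (A + B) i)
    \<le> (\<Sum>i<k. singular_value_seq A i + singular_value_seq B i)"
proof -
  let ?p = "dim_row B" and ?m = "dim_col B"
  have c: "A \<in> carrier_mat ?p ?m" "B \<in> carrier_mat ?p ?m" "A + B \<in> carrier_mat ?p ?m"
    using assms by auto
  obtain U V where UV: "U \<in> carrier_mat ?p k" "op_bound 1 U" "V \<in> carrier_mat ?m k" "op_bound 1 V"
    and eq: "(\<Sum>j<k. (U\<^sup>T * (A + B) * V) $$ (j, j)) = (\<Sum>i<k. singular_value_seq (A + B) i)"
    by (rule Ky_Fan_attained[OF c(3)])
  have "U\<^sup>T * (A + B) * V = U\<^sup>T * A * V + U\<^sup>T * B * V"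
    using UV(1,3) assms by (simp add: mat_distribs del: assoc_mult_mat)
  then have "(\<Sum>j<k. (U\<^sup>T * (A + B) * V) $$ (j, j))
      = (\<Sum>j<k. (U\<^sup>T * A * V) $$ (j, j)) + (\<Sum>j<k. (U\<^sup>T * B * V) $$ (j, j))"
    using UV(1,3) by (simp add: sum.distrib del: index_mult_mat(1))
  then show ?thesis
    using Ky_Fan_upper[OF c(1) UV] Ky_Fan_upper[OF c(2) UV] by (simp add: eq sum.distrib)
qed

lemma Ky_Fan_transpose: "(\<Sum>i<k. singular_value_seq A\<^sup>T i) \<le> (\<Sum>i<k. singular_value_seq A i)"
proof -
  let ?p = "dim_row A" and ?m = "dim_col A"
  have c: "A \<in> carrier_mat ?p ?m" "A\<^sup>T \<in> carrier_mat ?m ?p" by auto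
  obtain U V where UV: "U \<in> carrier_mat ?m k" "op_bound 1 U" "V \<in> carrier_mat ?p k" "op_bound 1 V"
    and eq: "(\<Sum>j<k. (U\<^sup>T * A\<^sup>T * V) $$ (j, j)) = (\<Sum>i<k. singular_value_seq A\<^sup>T i)"
    by (rule Ky_Fan_attained[OF c(2)])
  have "U\<^sup>T * A\<^sup>T * V = (V\<^sup>T * A * U)\<^sup>T"
    using UV(1,3) by (simp add: mat_transposes mat_assoc del: assoc_mult_mat)
  then have "(U\<^sup>T * A\<^sup>T * V) $$ (j, j) = (V\<^sup>T * A * U) $$ (j, j)" if "j < k" for j
    using UV(1,3) that by (simp del: index_mult_mat(1))
  then show ?thesis
    using Ky_Fan_upper[OF c(1) UV(3,4,1,2)] by (simp add: eq[symmetric] del: index_mult_mat(1))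
qed

text \<open>The factor \<open>C\<close> moves into the test matrix: \<open>C\<^sup>T * U\<close>
  divided by \<open>c\<close> is again a contraction. The case \<open>c = 0\<close> follows from
  arbitrarily small positive bounds.\<close>

lemma Ky_Fan_mult_left:
  assumes C: "op_bound c C" "dim_col C = dim_row A"
  shows "(\<Sum>i<k. singular_value_seq (C * A) i) \<le> c * (\<Sum>i<k. singular_value_seq A i)"
proof -
  have pos: "(\<Sum>i<k. singular_value_seq (C * A) i) \<le> c * (\<Sum>i<k. singular_value_seq A i)"
    if "op_bound c C" "0 < c" for c
  proof -
    let ?p = "dim_row C" and ?q = "dim_row A" and ?m = "dim_col A"
    have cA: "A \<in> carrier_mat ?q ?m" "C * A \<in> carrier_mat ?p ?m" by auto
    obtain U V where UV: "U \<in> carrier_mat ?p k" "op_bound 1 U" "V \<in> carrier_mat ?m k" "op_bound 1 V"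
      and eq: "(\<Sum>j<k. (U\<^sup>T * (C * A) * V) $$ (j, j)) = (\<Sum>i<k. singular_value_seq (C * A) i)"
      by (rule Ky_Fan_attained[OF cA(2)])
    define W where "W = (1 / c) \<cdot>\<^sub>m (C\<^sup>T * U)"
    have W: "W \<in> carrier_mat ?q k" using UV C by (auto simp: W_def)
    have "op_bound (\<bar>1 / c\<bar> * (c * 1)) W" unfolding W_def
      using UV by (intro op_bound_smult op_bound_mult op_bound_transpose that) auto
    then have W1: "op_bound 1 W" using that by simp
    have "U\<^sup>T * (C * A) * V = (C\<^sup>T * U)\<^sup>T * A * V"
      using UV C by (simp add: mat_transposes mat_assoc del: assoc_mult_mat)
    also have "C\<^sup>T * U = c \<cdot>\<^sub>m W" unfolding W_def using that by (intro eq_matI) auto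
    also have "(c \<cdot>\<^sub>m W)\<^sup>T = c \<cdot>\<^sub>m W\<^sup>T" by (intro eq_matI) auto
    also have "c \<cdot>\<^sub>m W\<^sup>T * A = c \<cdot>\<^sub>m (W\<^sup>T * A)" using W by (intro mult_smult_assoc_mat) auto
    also have "\<dots> * V = c \<cdot>\<^sub>m (W\<^sup>T * A * V)"
      using W UV by (intro mult_smult_assoc_mat[of _ k ?m _ k]) auto
    finally have *: "U\<^sup>T * (C * A) * V = c \<cdot>\<^sub>m (W\<^sup>T * A * V)" .
    have "(\<Sum>i<k. singular_value_seq (C * A) i) = c * (\<Sum>j<k. (W\<^sup>T * A * V) $$ (j, j))"
      unfolding eq[symmetric] * sum_distrib_left using W UV
      by (intro sum.cong) (auto simp del: index_mult_mat(1))
    also have "\<dots> \<le> c * (\<Sum>i<k. singular_value_seq A i)"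
      using that by (intro mult_left_mono Ky_Fan_upper[OF cA(1) W W1 UV(3,4)]) auto
    finally show ?thesis .
  qed
  show ?thesis
  proof (cases "c = 0")
    case False
    then show ?thesis using pos[OF C(1)] op_bound_nonneg[OF C(1)] by simp
  next
    case True
    let ?s = "\<Sum>i<k. singular_value_seq A i"
    have s: "0 \<le> ?s" by (intro sum_nonneg singular_value_seq_nonneg)
    have "(\<Sum>i<k. singular_value_seq (C * A) i) \<le> 0 + e" if "0 < e" for e
    proof -
      \<comment> \<open>The bound \<open>e / (?s + 1)\<close> is positive, and its product with the
        Ky Fan sum \<open>?s\<close> stays below \<open>e\<close>.\<close>
      have "(\<Sum>i<k. singular_value_seq (C * A) i) \<le> e / (?s + 1) * ?s"
        using that s by (intro pos op_bound_mono[OF C(1)]) (auto simp: True)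
      also have "\<dots> \<le> e" using that s by (simp add: field_simps)
      finally show ?thesis by simp
    qed
    then have "(\<Sum>i<k. singular_value_seq (C * A) i) \<le> 0" by (rule field_le_epsilon)
    then show ?thesis by (simp add: True)
  qed
qed

text \<open>Ky Fan dominance: weak majorization settles the comparison for every symmetric gauge at
  once. The sizes of \<open>A\<close> and \<open>B\<close> may differ, because the gauge sees only
  the padded sequences.\<close>

lemma unitarily_invariant_norm_le:
  assumes "unitarily_invariant_norm N" "0 \<le> c"
    and "\<And>k. (\<Sum>i<k. singular_value_seq A i) \<le> c * (\<Sum>i<k. singular_value_seq B i)"
  shows "N A \<le> c * N B"
proof -
  obtain \<Phi> where g: "symmetric_gauge \<Phi>" and N: "\<And>A. N A = \<Phi> (singular_value_seq A)"
    using assms(1) unfolding unitarily_invariant_norm_def by blast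
  have "\<Phi> (singular_value_seq A) \<le> \<Phi> (\<lambda>i. c * singular_value_seq B i)"
    by (rule gauge_weak_majorization[OF g finitely_supported_singular_value_seq
          finitely_supported_mult[OF finitely_supported_singular_value_seq]
          singular_value_seq_nonneg singular_value_seq_decreasing])
      (simp_all add: sum_distrib_left[symmetric] assms(3))
  then show ?thesis
    using assms(2) by (simp add: N gauge_mult[OF g finitely_supported_singular_value_seq])
qed

lemma unitarily_invariant_norm_nonneg: "unitarily_invariant_norm N \<Longrightarrow> 0 \<le> N A"
  unfolding unitarily_invariant_norm_def
  using gauge_nonneg[OF _ finitely_supported_singular_value_seq[of A]] by (elim exE conjE) simp

text \<open>The singular values of \<open>A + B\<close> are weakly majorized by the pointwise sum of
  the two sequences, to which the triangle inequality of the gauge applies.\<close>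

lemma unitarily_invariant_norm_triangle:
  assumes "unitarily_invariant_norm N" "dim_row A = dim_row B" "dim_col A = dim_col B"
  shows "N (A + B) \<le> N A + N B"
proof -
  obtain \<Phi> where g: "symmetric_gauge \<Phi>" and N: "\<And>A. N A = \<Phi> (singular_value_seq A)"
    using assms(1) unfolding unitarily_invariant_norm_def by blast
  let ?s = "\<lambda>i. singular_value_seq A i + singular_value_seq B i"
  have "finitely_supported ?s"
    unfolding finitely_supported_def
    by (rule finite_subset[of _ "{i. singular_value_seq A i \<noteq> 0} \<union> {i. singular_value_seq B i \<noteq> 0}"])
      (auto simp: finitely_supported_singular_value_seq[unfolded finitely_supported_def])
  from gauge_weak_majorization[OF g finitely_supported_singular_value_seq this
      singular_value_seq_nonneg singular_value_seq_decreasing Ky_Fan_add[OF assms(2,3)]]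
  have "\<Phi> (singular_value_seq (A + B)) \<le> \<Phi> ?s" by simp
  also have "\<dots> \<le> \<Phi> (singular_value_seq A) + \<Phi> (singular_value_seq B)"
    by (rule gauge_triangle[OF g finitely_supported_singular_value_seq finitely_supported_singular_value_seq])
  finally show ?thesis by (simp add: N)
qed

lemma unitarily_invariant_norm_transpose:
  assumes "unitarily_invariant_norm N"
  shows "N A\<^sup>T = N A"
proof (rule antisym)
  show "N A\<^sup>T \<le> N A"
    using unitarily_invariant_norm_le[OF assms, of 1 "A\<^sup>T" A] Ky_Fan_transpose[where A=A] by simp
  show "N A \<le> N A\<^sup>T"
    using unitarily_invariant_norm_le[OF assms, of 1 A "A\<^sup>T"] Ky_Fan_transpose[where A="A\<^sup>T"] by simp
qed

lemma unitarily_invariant_norm_mult_left: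
  assumes "unitarily_invariant_norm N" "op_bound c C" "dim_col C = dim_row A"
  shows "N (C * A) \<le> c * N A"
  by (rule unitarily_invariant_norm_le[OF assms(1) op_bound_nonneg[OF assms(2)] Ky_Fan_mult_left[OF assms(2,3)]])

lemma unitarily_invariant_norm_mult_right:
  assumes "unitarily_invariant_norm N" "op_bound c C" "dim_row C = dim_col A"
  shows "N (A * C) \<le> c * N A"
proof -
  have "N (A * C) = N (C\<^sup>T * A\<^sup>T)"
    using unitarily_invariant_norm_transpose[OF assms(1), of "A * C"] assms(3) by (simp add: mat_transposes)
  also have "\<dots> \<le> c * N A\<^sup>T"
    using assms by (intro unitarily_invariant_norm_mult_left op_bound_transpose) auto
  finally show ?thesis by (simp add: unitarily_invariant_norm_transpose[OF assms(1)])
qed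

text \<open>Scaling is left multiplication by a constant diagonal matrix, so the product estimate
  covers it.\<close>

lemma unitarily_invariant_norm_smult:
  assumes "unitarily_invariant_norm N"
  shows "N (a \<cdot>\<^sub>m A) \<le> \<bar>a\<bar> * N A"
proof -
  have "N (mat_diag (dim_row A) (\<lambda>_. a) * A) \<le> \<bar>a\<bar> * N A"
    by (intro unitarily_invariant_norm_mult_left assms op_bound_mat_diag) auto
  then show ?thesis by (simp add: mat_diag_const_mult)
qed

lemma unitarily_invariant_norm_diff:
  assumes "unitarily_invariant_norm N" "dim_row A = dim_row B" "dim_col A = dim_col B"
  shows "N (A - B) \<le> N A + N B"
proof -
  have "A - B = A + (-1) \<cdot>\<^sub>m B" using assms by (intro eq_matI) auto
  then have "N (A - B) \<le> N A + N ((-1) \<cdot>\<^sub>m B)"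
    using unitarily_invariant_norm_triangle[OF assms(1), of A "(-1) \<cdot>\<^sub>m B"] assms by simp
  also have "N ((-1) \<cdot>\<^sub>m B) \<le> N B"
    using unitarily_invariant_norm_smult[OF assms(1), of "-1" B] by simp
  finally show ?thesis by simp
qed

section \<open>Gram matrices and the spectra of 1 - A B and 1 - B A\<close>

lemma unitarily_invariant_norm_gram:
  assumes "unitarily_invariant_norm N" "char_poly (A\<^sup>T * A) = char_poly (B\<^sup>T * B)"
  shows "N A = N B"
proof -
  have "singular_value_seq A = singular_value_seq B"
    unfolding singular_value_seq_def singular_values_def assms(2) ..
  then show ?thesis using assms(1) unfolding unitarily_invariant_norm_def by metis
qed

text \<open>One block determinant is computed twice. The Schur complement of the identity block
  gives \<open>det (Y + A * B)\<close>; clearing the block \<open>B\<close> by the lower triangular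
  \<open>?L\<close>, whose determinant is \<open>det Y\<close>, gives
  \<open>det Y * det (Y + B * A)\<close>. Cancelling \<open>det Y\<close> requires only an integral
  domain, such as polynomials.\<close>

lemma det_scalar_add_mult_commute:
  fixes A B :: "'a :: idom mat"
  assumes A: "A \<in> carrier_mat n n" and B: "B \<in> carrier_mat n n" and y: "y \<noteq> 0"
  shows "det (y \<cdot>\<^sub>m 1\<^sub>m n + A * B) = det (y \<cdot>\<^sub>m 1\<^sub>m n + B * A)"
proof -
  define Y where "Y = y \<cdot>\<^sub>m (1\<^sub>m n :: 'a mat)"
  have Y: "Y \<in> carrier_mat n n" by (simp add: Y_def)
  let ?G = "four_block_mat Y (- A) B (1\<^sub>m n)" and ?L = "four_block_mat (1\<^sub>m n) (0\<^sub>m n n) (- B) Y"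
  have "det ?G = det (Y * 1\<^sub>m n - (- A) * B)"
    using A B Y by (intro det_four_block_mat) auto
  also have "Y * 1\<^sub>m n - (- A) * B = Y + A * B"
    using A B Y by (simp add: mat_one_mult) (auto intro!: eq_matI)
  finally have 1: "det ?G = det (Y + A * B)" .
  have "?L * ?G = four_block_mat Y (- A) (0\<^sub>m n n) (Y + B * A)"
  proof -
    have "- B * Y + Y * B = 0\<^sub>m n n"
      using B by (intro eq_matI) (auto simp: Y_def mult_smult_distrib[of _ n n _ n] mult_smult_assoc_mat[of _ n n _ n])
    moreover have "(- B) * (- A) + Y * 1\<^sub>m n = Y + B * A"
      using A B Y by (simp add: mat_one_mult) (auto intro!: eq_matI)
    moreover have "1\<^sub>m n * Y + 0\<^sub>m n n * B = Y" "1\<^sub>m n * (- A) + 0\<^sub>m n n * 1\<^sub>m n = - A"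
      using A B Y by (auto simp: mat_one_mult)
    ultimately show ?thesis
      using A B Y by (subst mult_four_block_mat[of _ n n _ n _ n _ _ n _ n]) auto
  qed
  then have "det ?L * det ?G = det Y * det (Y + B * A)"
    using A B Y by (subst det_mult[of _ "n + n", symmetric])
      (auto intro!: det_four_block_mat_lower_left_zero[of _ n _ n])
  moreover have "det ?L = det Y"
    using B Y by (subst det_four_block_mat_upper_right_zero[of _ n _ n]) auto
  moreover have "det Y \<noteq> 0" using y by (simp add: Y_def)
  ultimately have "det ?G = det (Y + B * A)" by simp
  with 1 show ?thesis by (simp add: Y_def)
qed

text \<open>Since x - (1 - A B) = (x - 1) + A B, the determinant identity applies over polynomials
  with the nonzero scalar \<open>[:-1, 1:]\<close>.\<close>

lemma char_poly_one_minus_mult_commute: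
  fixes A B :: "'a :: idom mat"
  assumes A: "A \<in> carrier_mat n n" and B: "B \<in> carrier_mat n n"
  shows "char_poly (1\<^sub>m n - A * B) = char_poly (1\<^sub>m n - B * A)"
proof -
  have cpm: "char_poly_matrix (1\<^sub>m n - A * B) =
      [:-1, 1:] \<cdot>\<^sub>m 1\<^sub>m n + map_mat (\<lambda>a. [:a:]) A * map_mat (\<lambda>a. [:a:]) B"
    if "A \<in> carrier_mat n n" "B \<in> carrier_mat n n" for A B :: "'a mat"
  proof (rule eq_matI)
    have add: "[:a + b:] = [:a:] + [:b:]" for a b :: 'a by simp
    have sum: "[:\<Sum>k<l. f k:] = (\<Sum>k<l. [:f k:])" for f :: "nat \<Rightarrow> 'a" and l
    proof (induction l)
      case (Suc l)
      then show ?case by (simp only: sum.lessThan_Suc add)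
    qed simp
    fix i j
    assume "i < dim_row ([:-1, 1:] \<cdot>\<^sub>m 1\<^sub>m n + map_mat (\<lambda>a. [:a:]) A * map_mat (\<lambda>a. [:a:]) B)"
      "j < dim_col ([:-1, 1:] \<cdot>\<^sub>m 1\<^sub>m n + map_mat (\<lambda>a. [:a:]) A * map_mat (\<lambda>a. [:a:]) B)"
    with that have ij: "i < n" "j < n" by auto
    have "(map_mat (\<lambda>a. [:a:]) A * map_mat (\<lambda>a. [:a:]) B) $$ (i, j)
        = (\<Sum>k<n. [:A $$ (i, k):] * [:B $$ (k, j):])"
      using ij that by (simp add: scalar_prod_def atLeast0LessThan del: mult_pCons_left)
    also have "\<dots> = [:\<Sum>k<n. A $$ (i, k) * B $$ (k, j):]" unfolding sum by (simp add: mult.commute)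
    also have "(\<Sum>k<n. A $$ (i, k) * B $$ (k, j)) = (A * B) $$ (i, j)"
      using ij that by (simp add: scalar_prod_def atLeast0LessThan)
    finally have AB: "(map_mat (\<lambda>a. [:a:]) A * map_mat (\<lambda>a. [:a:]) B) $$ (i, j) = [:(A * B) $$ (i, j):]" .
    have "char_poly_matrix (1\<^sub>m n - A * B) $$ (i, j)
        = (if i = j then [:-1, 1:] else 0) + [:(A * B) $$ (i, j):]"
      using ij that by (simp add: char_poly_matrix_def del: index_mult_mat(1))
    also have "\<dots> = ([:-1, 1:] \<cdot>\<^sub>m 1\<^sub>m n + map_mat (\<lambda>a. [:a:]) A * map_mat (\<lambda>a. [:a:]) B) $$ (i, j)"
      using ij that by (simp add: AB one_pCons del: index_mult_mat(1))
    finally show "char_poly_matrix (1\<^sub>m n - A * B) $$ (i, j) =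
        ([:-1, 1:] \<cdot>\<^sub>m 1\<^sub>m n + map_mat (\<lambda>a. [:a:]) A * map_mat (\<lambda>a. [:a:]) B) $$ (i, j)" .
  qed (use that in \<open>simp_all add: char_poly_matrix_def\<close>)
  show ?thesis
    unfolding char_poly_def cpm[OF A B] cpm[OF B A]
    by (rule det_scalar_add_mult_commute) (use A B in simp_all)
qed

section \<open>Perturbation of the leading singular subspaces\<close>

text \<open>Both Gram matrices are the identity minus the product of \<open>A\<^sup>T * B\<close>
  and \<open>B\<^sup>T * A\<close>, taken in opposite orders, so their characteristic polynomials
  agree. This makes the sines between two subspaces independent of which one is projected
  away.\<close>

lemma unitarily_invariant_norm_complement_swap:
  assumes N: "unitarily_invariant_norm N"
    and A: "A \<in> carrier_mat p r" "A\<^sup>T * A = 1\<^sub>m r" and B: "B \<in> carrier_mat p r" "B\<^sup>T * B = 1\<^sub>m r"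
  shows "N ((1\<^sub>m p - A * A\<^sup>T) * B) = N ((1\<^sub>m p - B * B\<^sup>T) * A)"
proof -
  have gram: "((1\<^sub>m p - A * A\<^sup>T) * B)\<^sup>T * ((1\<^sub>m p - A * A\<^sup>T) * B) = 1\<^sub>m r - (B\<^sup>T * A) * (A\<^sup>T * B)"
    if A: "A \<in> carrier_mat p r" "A\<^sup>T * A = 1\<^sub>m r" and B: "B \<in> carrier_mat p r" "B\<^sup>T * B = 1\<^sub>m r"
    for A B :: "real mat"
  proof -
    have dims [simp]: "dim_row A = p" "dim_col A = r" "dim_row B = p" "dim_col B = r" using A B by auto
    \<comment> \<open>\<open>A\<^sup>T\<close> annihilates the complement of the range of
      \<open>A\<close>, so only one copy of the projection survives in the Gram matrix.\<close>
    have "A\<^sup>T * ((1\<^sub>m p - A * A\<^sup>T) * B) = A\<^sup>T * B - (A\<^sup>T * A) * (A\<^sup>T * B)"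
      by (simp add: mat_distribs mat_assoc mat_one_mult del: assoc_mult_mat)
    also have "\<dots> = 0\<^sub>m r r" unfolding A(2) by (rule eq_matI) (auto simp: mat_one_mult)
    finally have 0: "A\<^sup>T * ((1\<^sub>m p - A * A\<^sup>T) * B) = 0\<^sub>m r r" .
    have "((1\<^sub>m p - A * A\<^sup>T) * B)\<^sup>T = B\<^sup>T - B\<^sup>T * A * A\<^sup>T"
      by (simp add: mat_transposes mat_distribs mat_assoc mat_one_mult del: assoc_mult_mat)
    then have "((1\<^sub>m p - A * A\<^sup>T) * B)\<^sup>T * ((1\<^sub>m p - A * A\<^sup>T) * B)
        = B\<^sup>T * ((1\<^sub>m p - A * A\<^sup>T) * B) - B\<^sup>T * A * (A\<^sup>T * ((1\<^sub>m p - A * A\<^sup>T) * B))"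
      by (simp add: mat_distribs(4) mat_assoc del: assoc_mult_mat)
    also have "\<dots> = B\<^sup>T * ((1\<^sub>m p - A * A\<^sup>T) * B)"
      unfolding 0 by (rule eq_matI) (auto simp del: index_mult_mat(1) simp: right_mult_zero_mat[of _ r r])
    also have "\<dots> = B\<^sup>T * B - (B\<^sup>T * A) * (A\<^sup>T * B)"
      by (simp add: mat_distribs mat_assoc mat_one_mult del: assoc_mult_mat)
    finally show ?thesis by (simp only: B(2))
  qed
  show ?thesis
    unfolding gram[OF A B, symmetric]
    by (rule unitarily_invariant_norm_gram[OF N], unfold gram[OF A B] gram[OF B A],
        rule char_poly_one_minus_mult_commute[of _ r]) (use A B in auto)
qed

text \<open>The decompositions enter only through intertwining relations of the leading blocks and a
  bound on the residual of \<open>Y\<close>, a form that transposition preserves. The leading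
  singular values of \<open>X\<close> lie between \<open>a\<close> and \<open>b\<close>, those of
  \<open>Y\<close> between 0 and \<open>bh\<close>.\<close>

locale svd_perturbation =
  fixes p m r :: nat and X Y A B Ah Bh :: "real mat" and d dh :: "nat \<Rightarrow> real"
    and N :: "real mat \<Rightarrow> real" and a b bh \<delta> :: real
  assumes XY: "X \<in> carrier_mat p m" "Y \<in> carrier_mat p m"
    and AB: "A \<in> carrier_mat p r" "B \<in> carrier_mat m r"
    and ABh: "Ah \<in> carrier_mat p r" "Bh \<in> carrier_mat m r"
    and A: "A\<^sup>T * A = 1\<^sub>m r" and B: "B\<^sup>T * B = 1\<^sub>m r"
    and Ah: "Ah\<^sup>T * Ah = 1\<^sub>m r" and Bh: "Bh\<^sup>T * Bh = 1\<^sub>m r"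
    and AX: "A\<^sup>T * X = mat_diag r d * B\<^sup>T" and XB: "X * B = A * mat_diag r d"
    and AhY: "Ah\<^sup>T * Y = mat_diag r dh * Bh\<^sup>T" and YBh: "Y * Bh = Ah * mat_diag r dh"
    and Y2: "op_bound (a - \<delta>) (Y - Ah * mat_diag r dh * Bh\<^sup>T)"
    and \<delta>: "0 < \<delta>"
    and d: "\<And>i. i < r \<Longrightarrow> a \<le> d i" "\<And>i. i < r \<Longrightarrow> d i \<le> b"
    and dh: "\<And>i. i < r \<Longrightarrow> 0 \<le> dh i" "\<And>i. i < r \<Longrightarrow> dh i \<le> bh"
    and ab: "a \<le> b" "0 \<le> bh"
    and N: "unitarily_invariant_norm N"
begin

abbreviation "D \<equiv> mat_diag r d"
abbreviation "Dh \<equiv> mat_diag r dh"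
abbreviation "E \<equiv> X - Y"

text \<open>\<open>S\<close> and \<open>R\<close> hold the parts of the leading singular vectors of
  \<open>X\<close> orthogonal to those of \<open>Y\<close>, on the left and on the right.
  \<open>T\<close> and \<open>T'\<close> measure the same angles with the roles of \<open>X\<close>
  and \<open>Y\<close> exchanged.\<close>

definition "S = A\<^sup>T * (1\<^sub>m p - Ah * Ah\<^sup>T)"
definition "R = B\<^sup>T * (1\<^sub>m m - Bh * Bh\<^sup>T)"
definition "T = (1\<^sub>m p - A * A\<^sup>T) * Ah"
definition "T' = (1\<^sub>m m - B * B\<^sup>T) * Bh"
definition "\<epsilon> = max (N (A\<^sup>T * E)) (N (E * B))"

lemma dims [simp]:
  "dim_row X = p" "dim_col X = m" "dim_row Y = p" "dim_col Y = m"
  "dim_row A = p" "dim_col A = r" "dim_row Ah = p" "dim_col Ah = r"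
  "dim_row B = m" "dim_col B = r" "dim_row Bh = m" "dim_col Bh = r"
  "dim_row S = r" "dim_col S = p" "dim_row R = r" "dim_col R = m"
  "dim_row T = p" "dim_col T = r" "dim_row T' = m" "dim_col T' = r"
  using XY AB ABh by (auto simp: S_def R_def T_def T'_def)

lemmas expand = mat_distribs mat_assoc mat_one_mult mat_transposes
declare assoc_mult_mat [simp del]
declare index_mult_mat(1) [simp del]

lemma a_pos: "0 < a"
  using op_bound_nonneg[OF Y2] \<delta> by simp

lemma op_bounds: "op_bound 1 A" "op_bound 1 B" "op_bound 1 Ah" "op_bound 1 Bh"
  using A B Ah Bh by (auto intro: op_bound_orthonormal)

lemma op_bound_D: "op_bound b D"
  using d a_pos ab by (intro op_bound_mat_diag) (force simp: abs_le_iff)+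

lemma op_bound_Dh: "op_bound bh Dh"
  using dh ab by (intro op_bound_mat_diag) (force simp: abs_le_iff)+

lemma \<epsilon>: "N (A\<^sup>T * E) \<le> \<epsilon>" "N (E * B) \<le> \<epsilon>" "0 \<le> \<epsilon>"
  using unitarily_invariant_norm_nonneg[OF N, of "E * B"] by (auto simp: \<epsilon>_def)

lemmas N_left = unitarily_invariant_norm_mult_left[OF N]
lemmas N_right = unitarily_invariant_norm_mult_right[OF N]
lemmas N_add = unitarily_invariant_norm_triangle[OF N]
lemmas N_diff = unitarily_invariant_norm_diff[OF N]
lemmas N_transpose = unitarily_invariant_norm_transpose[OF N]
lemmas N_nonneg = unitarily_invariant_norm_nonneg[OF N]

lemma N_left1: "op_bound 1 C \<Longrightarrow> dim_col C = dim_row M \<Longrightarrow> N M \<le> c \<Longrightarrow> N (C * M) \<le> c"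
  using N_left[of 1 C M] by simp

lemma N_right1: "op_bound 1 C \<Longrightarrow> dim_row C = dim_col M \<Longrightarrow> N M \<le> c \<Longrightarrow> N (M * C) \<le> c"
  using N_right[of 1 C M] by simp

section \<open>Angles between the leading subspaces, and the truncated matrices\<close>

lemma residual_eq: "Y * (1\<^sub>m m - Bh * Bh\<^sup>T) = Y - Ah * Dh * Bh\<^sup>T"
    "(1\<^sub>m p - Ah * Ah\<^sup>T) * (Y - Ah * Dh * Bh\<^sup>T) = Y - Ah * Dh * Bh\<^sup>T"
proof -
  have "Y * (1\<^sub>m m - Bh * Bh\<^sup>T) = Y - (Y * Bh) * Bh\<^sup>T" by (simp add: expand)
  then show "Y * (1\<^sub>m m - Bh * Bh\<^sup>T) = Y - Ah * Dh * Bh\<^sup>T" by (simp only: YBh)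
  have "(1\<^sub>m p - Ah * Ah\<^sup>T) * (Y - Ah * Dh * Bh\<^sup>T)
      = Y - Ah * Dh * Bh\<^sup>T - (Ah * (Ah\<^sup>T * Y) - Ah * ((Ah\<^sup>T * Ah) * (Dh * Bh\<^sup>T)))"
    by (rule eq_matI) (auto simp: expand)
  also have "\<dots> = Y - Ah * Dh * Bh\<^sup>T"
    unfolding AhY Ah by (rule eq_matI) (auto simp: expand)
  finally show "(1\<^sub>m p - Ah * Ah\<^sup>T) * (Y - Ah * Dh * Bh\<^sup>T) = Y - Ah * Dh * Bh\<^sup>T" .
qed

text \<open>Left multiplication by \<open>D\<close> expands \<open>R\<close> by at least
  \<open>a\<close>, while the residual of \<open>Y\<close> contracts \<open>S\<close> by
  \<open>a - \<delta>\<close>; what remains is the error \<open>A\<^sup>T * E\<close>.\<close>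

lemma coupled_bound: "a * N R \<le> N (A\<^sup>T * E) + (a - \<delta>) * N S"
proof -
  let ?Y = "Y - Ah * Dh * Bh\<^sup>T" and ?Q = "1\<^sub>m m - Bh * Bh\<^sup>T"
  have "D * R = (A\<^sup>T * X) * ?Q" unfolding AX R_def by (simp add: mat_assoc)
  also have "A\<^sup>T * X = A\<^sup>T * E + A\<^sup>T * Y" by (rule eq_matI) (auto simp: expand)
  also have "(A\<^sup>T * E + A\<^sup>T * Y) * ?Q = A\<^sup>T * E * ?Q + A\<^sup>T * (Y * ?Q)"
    by (subst mat_distribs(3)) (simp_all add: mat_assoc)
  \<comment> \<open>Inserting the left projection, which fixes the residual, turns
    \<open>A\<^sup>T\<close> into \<open>S\<close>.\<close>
  also have "Y * ?Q = (1\<^sub>m p - Ah * Ah\<^sup>T) * ?Y" by (simp only: residual_eq)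
  also have "A\<^sup>T * ((1\<^sub>m p - Ah * Ah\<^sup>T) * ?Y) = S * ?Y" unfolding S_def by (simp add: mat_assoc)
  finally have DR: "D * R = A\<^sup>T * E * ?Q + S * ?Y" .
  have "mat_diag r (\<lambda>i. 1 / d i) * (D * R) = mat_diag r (\<lambda>i. 1 / d i * d i) * R"
    by (simp add: mat_assoc[symmetric])
  also have "mat_diag r (\<lambda>i. 1 / d i * d i) = 1\<^sub>m r"
    using d a_pos by (intro eq_matI) (auto simp: mat_diag_def, force)
  finally have "N R = N (mat_diag r (\<lambda>i. 1 / d i) * (D * R))" by (simp add: mat_one_mult)
  also have "\<dots> \<le> 1 / a * N (D * R)"
    using d a_pos by (intro N_left op_bound_mat_diag) (auto simp: frac_le abs_of_pos order_less_le_trans)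
  finally have "a * N R \<le> N (D * R)" using a_pos by (simp add: field_simps)
  also have "\<dots> \<le> N (A\<^sup>T * E * ?Q) + N (S * ?Y)" unfolding DR by (intro N_add) auto
  also have "N (A\<^sup>T * E * ?Q) \<le> N (A\<^sup>T * E)"
    by (rule N_right1[OF op_bound_complement[OF op_bounds(4)]]) auto
  also have "N (S * ?Y) \<le> (a - \<delta>) * N S" by (intro N_right Y2) auto
  finally show ?thesis by simp
qed

text \<open>Transposing exchanges left and right singular vectors, and with them \<open>S\<close>
  and \<open>R\<close>, so each one-sided estimate yields its mirror image.\<close>

lemma transpose: "svd_perturbation m p r X\<^sup>T Y\<^sup>T B A Bh Ah d dh N a b bh \<delta>"
proof
  show "B\<^sup>T * X\<^sup>T = D * A\<^sup>T" using arg_cong[OF XB, of transpose_mat] by (simp add: mat_transposes)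
  show "X\<^sup>T * A = B * D" using arg_cong[OF AX, of transpose_mat] by (simp add: mat_transposes)
  show "Bh\<^sup>T * Y\<^sup>T = Dh * Ah\<^sup>T" using arg_cong[OF YBh, of transpose_mat] by (simp add: mat_transposes)
  show "Y\<^sup>T * Ah = Bh * Dh" using arg_cong[OF AhY, of transpose_mat] by (simp add: mat_transposes)
  show "op_bound (a - \<delta>) (Y\<^sup>T - Bh * Dh * Ah\<^sup>T)"
    using op_bound_transpose[OF Y2] by (simp add: mat_transposes mat_assoc)
qed (use XY AB ABh A B Ah Bh \<delta> d dh ab N in auto)

text \<open>\<open>coupled_bound\<close> and its mirror image bound each of \<open>N S\<close> and
  \<open>N R\<close> by the other. For the larger of the two the term with
  \<open>a - \<delta>\<close> is absorbed on the left, which leaves the factor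
  \<open>\<delta>\<close>.\<close>

lemma sin_theta: "N S \<le> \<epsilon> / \<delta>" "N R \<le> \<epsilon> / \<delta>"
proof -
  interpret tr: svd_perturbation m p r "X\<^sup>T" "Y\<^sup>T" B A Bh Ah d dh N a b bh \<delta> by (rule transpose)
  have "N (B\<^sup>T * (X\<^sup>T - Y\<^sup>T)) = N (E * B)"
    using N_transpose[of "E * B"] by (simp add: mat_transposes)
  then have S: "a * N S \<le> \<epsilon> + (a - \<delta>) * N R"
    using tr.coupled_bound \<epsilon>(2) by (simp add: tr.S_def tr.R_def S_def R_def)
  have R: "a * N R \<le> \<epsilon> + (a - \<delta>) * N S" using coupled_bound \<epsilon>(1) by simp
  have a\<delta>: "0 \<le> a - \<delta>" by (rule op_bound_nonneg[OF Y2])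
  have "\<delta> * max (N S) (N R) \<le> \<epsilon>"
  proof (cases "N S \<le> N R")
    case True
    then have "(a - \<delta>) * N S \<le> (a - \<delta>) * N R" using a\<delta> by (rule mult_left_mono)
    then show ?thesis using True R by (simp add: algebra_simps max_def)
  next
    case False
    then have "(a - \<delta>) * N R \<le> (a - \<delta>) * N S" using a\<delta> by (intro mult_left_mono) auto
    then show ?thesis using False S by (simp add: algebra_simps max_def)
  qed
  then have "max (N S) (N R) \<le> \<epsilon> / \<delta>" using \<delta> by (simp only: pos_le_divide_eq mult.commute)
  then show "N S \<le> \<epsilon> / \<delta>" "N R \<le> \<epsilon> / \<delta>" by auto
qed

text \<open>Swapping the complements gives \<open>N T = N S\<close> and
  \<open>N T' = N R\<close>.\<close>

lemma sin_theta': "N T \<le> \<epsilon> / \<delta>" "N T' \<le> \<epsilon> / \<delta>"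
proof -
  have "N T = N ((1\<^sub>m p - Ah * Ah\<^sup>T) * A)"
    unfolding T_def by (rule unitarily_invariant_norm_complement_swap[OF N AB(1) A ABh(1) Ah])
  also have "(1\<^sub>m p - Ah * Ah\<^sup>T) * A = S\<^sup>T" by (simp add: S_def mat_transposes)
  finally show "N T \<le> \<epsilon> / \<delta>" using sin_theta by (simp add: N_transpose)
  have "N T' = N ((1\<^sub>m m - Bh * Bh\<^sup>T) * B)"
    unfolding T'_def by (rule unitarily_invariant_norm_complement_swap[OF N AB(2) B ABh(2) Bh])
  also have "(1\<^sub>m m - Bh * Bh\<^sup>T) * B = R\<^sup>T" by (simp add: R_def mat_transposes)
  finally show "N T' \<le> \<epsilon> / \<delta>" using sin_theta by (simp add: N_transpose)
qed

text \<open>On the range of \<open>A\<close> the difference is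
  \<open>A * (A\<^sup>T * E) + A * (S * ?Y)\<close>, and on the complement it is
  \<open>T * (Dh * Bh\<^sup>T)\<close> with a minus sign. The first term costs
  \<open>\<epsilon>\<close>, the two sine terms cost \<open>b\<close> and \<open>bh\<close> times
  \<open>\<epsilon> / \<delta>\<close>.\<close>

lemma truncation_bound: "N (A * D * B\<^sup>T - Ah * Dh * Bh\<^sup>T) \<le> ((b + bh) / \<delta> + 1) * \<epsilon>"
proof -
  let ?Y1 = "Ah * Dh * Bh\<^sup>T" and ?Y = "Y - Ah * Dh * Bh\<^sup>T"
  have "A * D * B\<^sup>T = A * (A\<^sup>T * X)" unfolding AX by (simp add: mat_assoc)
  also have "A\<^sup>T * X = A\<^sup>T * E + (A\<^sup>T * ?Y + A\<^sup>T * ?Y1)" by (rule eq_matI) (auto simp: expand)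
  also have "A\<^sup>T * ?Y = S * ?Y"
    unfolding S_def by (simp add: mat_assoc[of "A\<^sup>T" "_ - _"] residual_eq)
  finally have "A * D * B\<^sup>T = A * (A\<^sup>T * E) + (A * (S * ?Y) + A * (A\<^sup>T * ?Y1))"
    by (simp add: mat_distribs(1))
  moreover have "T * (Dh * Bh\<^sup>T) = ?Y1 - A * (A\<^sup>T * ?Y1)" unfolding T_def by (simp add: expand)
  ultimately have eq: "A * D * B\<^sup>T - ?Y1 = A * (A\<^sup>T * E) + A * (S * ?Y) - T * (Dh * Bh\<^sup>T)"
    by (intro eq_matI) auto
  have "N (A * D * B\<^sup>T - ?Y1) \<le> N (A * (A\<^sup>T * E) + A * (S * ?Y)) + N (T * (Dh * Bh\<^sup>T))"
    unfolding eq by (intro N_diff) auto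
  also have "N (A * (A\<^sup>T * E) + A * (S * ?Y)) \<le> N (A * (A\<^sup>T * E)) + N (A * (S * ?Y))"
    by (intro N_add) auto
  also have "N (A * (A\<^sup>T * E)) \<le> \<epsilon>" by (intro N_left1 op_bounds \<epsilon>) auto
  also have "N (A * (S * ?Y)) \<le> (a - \<delta>) * N S" by (intro N_left1 op_bounds N_right Y2) auto
  also have "\<dots> \<le> b * (\<epsilon> / \<delta>)"
    using ab \<delta> op_bound_nonneg[OF Y2] by (intro mult_mono sin_theta N_nonneg) auto
  also have "N (T * (Dh * Bh\<^sup>T)) \<le> (bh * 1) * N T"
    by (intro N_right op_bound_mult op_bound_Dh op_bound_transpose op_bounds) auto
  also have "\<dots> \<le> bh * (\<epsilon> / \<delta>)" by (simp only: mult_1_right, intro mult_left_mono sin_theta' ab)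
  finally show ?thesis by (simp add: field_simps add_divide_distrib)
qed

section \<open>The Sylvester equation for the product of the cosine matrices\<close>

definition "M = A\<^sup>T * Ah"
definition "K = B\<^sup>T * Bh"
definition "H = M * Dh * M\<^sup>T"
definition "W = 1\<^sub>m r - M * K\<^sup>T"

lemma dims' [simp]:
  "dim_row M = r" "dim_col M = r" "dim_row K = r" "dim_col K = r"
  "dim_row H = r" "dim_col H = r" "dim_row W = r" "dim_col W = r"
  by (auto simp: M_def K_def H_def W_def)

lemma op_bounds': "op_bound 1 M" "op_bound 1 K"
  using op_bound_mult[OF op_bound_transpose[OF op_bounds(1)] op_bounds(3)]
    op_bound_mult[OF op_bound_transpose[OF op_bounds(2)] op_bounds(4)] by (auto simp: M_def K_def)

text \<open>Four near identities combine: \<open>D\<close> with \<open>M * M\<^sup>T * D\<close>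
  (error from \<open>S\<close>), this with \<open>M * Dh * K\<^sup>T\<close> (error from
  \<open>E * B\<close>), this with \<open>H * (M * K\<^sup>T)\<close> (error from \<open>T\<close>),
  and \<open>M * K\<^sup>T * D\<close> with \<open>H\<close> (error from
  \<open>A\<^sup>T * E\<close>).\<close>

lemma sylvester_residual:
  "H * W + W * D = S * (A * D) + M * (Ah\<^sup>T * (E * B)) + M * (Dh * ((Ah\<^sup>T * T) * K\<^sup>T))
     - M * (Bh\<^sup>T * (A\<^sup>T * E)\<^sup>T)"
proof -
  interpret tr: svd_perturbation m p r "X\<^sup>T" "Y\<^sup>T" B A Bh Ah d dh N a b bh \<delta> by (rule transpose)
  have "Bh\<^sup>T * (A\<^sup>T * E)\<^sup>T = Bh\<^sup>T * (X\<^sup>T * A) - (Bh\<^sup>T * Y\<^sup>T) * A" by (simp add: expand)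
  also have "\<dots> = K\<^sup>T * D - Dh * M\<^sup>T" unfolding tr.XB tr.AhY by (simp add: K_def M_def expand)
  finally have 1: "M * (Bh\<^sup>T * (A\<^sup>T * E)\<^sup>T) = M * K\<^sup>T * D - H" by (simp add: H_def expand)
  have "Ah\<^sup>T * (E * B) = Ah\<^sup>T * (X * B) - (Ah\<^sup>T * Y) * B" by (simp add: expand)
  also have "\<dots> = M\<^sup>T * D - Dh * K\<^sup>T" unfolding XB AhY by (simp add: K_def M_def expand)
  finally have 2: "M * (Ah\<^sup>T * (E * B)) = M * M\<^sup>T * D - M * Dh * K\<^sup>T" by (simp add: expand)
  have "Ah\<^sup>T * T = Ah\<^sup>T * Ah - M\<^sup>T * M" unfolding T_def M_def by (simp add: expand)
  then have 3: "M * (Dh * ((Ah\<^sup>T * T) * K\<^sup>T)) = M * Dh * K\<^sup>T - H * (M * K\<^sup>T)"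
    unfolding Ah by (simp add: expand H_def)
  have "S * (A * D) = (A\<^sup>T * A) * D - M * M\<^sup>T * D" unfolding S_def M_def by (simp add: expand)
  then have 4: "S * (A * D) = D - M * M\<^sup>T * D" unfolding A by (simp add: mat_one_mult)
  have 5: "H * W + W * D = (H - H * (M * K\<^sup>T)) + (D - M * K\<^sup>T * D)" unfolding W_def by (simp add: expand)
  show ?thesis unfolding 1 2 3 4 5 by (rule eq_matI) auto
qed

lemma sylvester_residual_bound: "N (H * W + W * D) \<le> 2 * \<epsilon> + (b + bh) * (\<epsilon> / \<delta>)"
proof -
  have "N (H * W + W * D) \<le> N (S * (A * D)) + N (M * (Ah\<^sup>T * (E * B)))
      + N (M * (Dh * ((Ah\<^sup>T * T) * K\<^sup>T))) + N (M * (Bh\<^sup>T * (A\<^sup>T * E)\<^sup>T))"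
    unfolding sylvester_residual
    by (rule order_trans[OF N_diff], simp, simp, intro add_mono order_refl,
        rule order_trans[OF N_add], simp, simp, intro add_mono order_refl N_add) auto
  also have "N (S * (A * D)) \<le> (1 * b) * N S"
    by (intro N_right op_bound_mult op_bounds op_bound_D) auto
  also have "\<dots> \<le> b * (\<epsilon> / \<delta>)" using a_pos ab by (simp only: mult_1, intro mult_left_mono sin_theta) simp
  also have "N (M * (Ah\<^sup>T * (E * B))) \<le> \<epsilon>"
    by (intro N_left1 op_bounds op_bounds' op_bound_transpose \<epsilon>) auto
  also have "N (M * (Bh\<^sup>T * (A\<^sup>T * E)\<^sup>T)) \<le> \<epsilon>"
    by (intro N_left1 op_bounds op_bounds' op_bound_transpose) (auto simp: N_transpose \<epsilon>)
  also have "N (M * (Dh * ((Ah\<^sup>T * T) * K\<^sup>T))) \<le> bh * N ((Ah\<^sup>T * T) * K\<^sup>T)"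
    by (intro N_left1 N_left op_bounds' op_bound_Dh) auto
  also have "\<dots> \<le> bh * (\<epsilon> / \<delta>)"
    by (intro mult_left_mono N_left1 N_right1 op_bounds op_bounds' op_bound_transpose sin_theta' ab) auto
  finally show ?thesis by (simp add: algebra_simps add_divide_distrib)
qed

text \<open>With \<open>s = a + b + bh\<close> the map \<open>W \<mapsto> (1/2 - H/s) W + W (1/2 - D/s)\<close> has norm at most
  \<open>1 - a/s\<close>; this bounds the solution of the Sylvester equation without inverting anything.\<close>

lemma sylvester_bound: "a * N W \<le> N (H * W + W * D)"
proof -
  define s where "s = a + b + bh"
  have s: "0 < s" "bh \<le> s" using a_pos ab by (auto simp: s_def)
  \<comment> \<open>A square root of \<open>H / s\<close>: since \<open>C * C\<^sup>T\<close> is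
    that matrix, the Gram bound with \<open>t = 1 / 2\<close> applies. It is a contraction because
    \<open>dh i \<le> bh \<le> s\<close>.\<close>
  define C where "C = M * mat_diag r (\<lambda>i. sqrt (dh i / s))"
  have "op_bound (1 * 1) C"
    unfolding C_def using dh s by (intro op_bound_mult op_bounds' op_bound_mat_diag) (force simp: field_simps)+
  then have C: "op_bound 1 C" by simp
  have dC [simp]: "dim_row C = r" "dim_col C = r" by (auto simp: C_def)
  have "C * C\<^sup>T = M * (mat_diag r (\<lambda>i. sqrt (dh i / s)) * mat_diag r (\<lambda>i. sqrt (dh i / s)) * M\<^sup>T)"
    unfolding C_def by (simp add: mat_assoc mat_transposes del: mat_diag_diag)
  also have "mat_diag r (\<lambda>i. sqrt (dh i / s)) * mat_diag r (\<lambda>i. sqrt (dh i / s)) = (1 / s) \<cdot>\<^sub>m Dh"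
    unfolding mat_diag_diag using dh s by (intro eq_matI) (auto simp: mat_diag_def)
  also have "M * ((1 / s) \<cdot>\<^sub>m Dh * M\<^sup>T) = (1 / s) \<cdot>\<^sub>m H"
    unfolding H_def by (simp add: mult_smult_assoc_mat[of _ r r _ r] mult_smult_distrib[of _ r r _ r] carrier_matI mat_assoc)
  finally have CC: "C * C\<^sup>T = (1 / s) \<cdot>\<^sub>m H" .
  define K1 where "K1 = (1 / 2) \<cdot>\<^sub>m 1\<^sub>m r - (1 / s) \<cdot>\<^sub>m H"
  define K2 where "K2 = mat_diag r (\<lambda>i. 1 / 2 - d i / s)"
  have K1: "op_bound (1 / 2) K1"
    using op_bound_scalar_minus_gram[OF C, of r "1 / 2"] by (simp add: K1_def CC)
  have K2: "op_bound (1 / 2 - a / s) K2"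
    unfolding K2_def
  proof (rule op_bound_mat_diag)
    fix i assume "i < r"
    \<comment> \<open>The summand \<open>a\<close> in \<open>s\<close> leaves a margin at the upper
      end too: \<open>d i / s\<close> lies between \<open>a / s\<close> and
      \<open>1 - a / s\<close>.\<close>
    then have "a \<le> d i" "d i + a \<le> s" using d[of i] ab by (auto simp: s_def)
    then have "a / s \<le> d i / s" "d i / s + a / s \<le> 1"
      using s by (auto simp: divide_right_mono add_divide_distrib[symmetric])
    then show "\<bar>1 / 2 - d i / s\<bar> \<le> 1 / 2 - a / s" by (auto simp: abs_le_iff)
  next
    have "2 * a \<le> s" using ab by (simp add: s_def)
    then show "0 \<le> 1 / 2 - a / s" using s by (simp add: field_simps)
  qed
  have [simp]: "dim_row K1 = r" "dim_col K1 = r" "dim_row K2 = r" "dim_col K2 = r"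
    by (auto simp: K1_def K2_def)
  have "K1 * W = (1 / 2) \<cdot>\<^sub>m W - (1 / s) \<cdot>\<^sub>m (H * W)"
    unfolding K1_def
    by (simp add: mat_distribs mult_smult_assoc_mat[of _ r r _ r] carrier_matI mat_one_mult)
  moreover have "W * K2 = (1 / 2) \<cdot>\<^sub>m W - (1 / s) \<cdot>\<^sub>m (W * D)"
  proof -
    have "K2 = (1 / 2) \<cdot>\<^sub>m 1\<^sub>m r - (1 / s) \<cdot>\<^sub>m D"
      unfolding K2_def by (rule eq_matI) (auto simp: mat_diag_def)
    then show ?thesis
      by (simp add: mat_distribs mult_smult_distrib[of _ r r _ r] carrier_matI mat_one_mult)
  qed
  \<comment> \<open>The Sylvester equation becomes a fixed-point identity. The bounds on
    \<open>K1\<close> and \<open>K2\<close> add up to \<open>1 - a / s\<close>, so this multiple of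
    \<open>N W\<close> can be absorbed on the left.\<close>
  ultimately have "W = K1 * W + W * K2 + (1 / s) \<cdot>\<^sub>m (H * W + W * D)"
    by (intro eq_matI) (auto simp: algebra_simps)
  then have "N W \<le> N (K1 * W + W * K2) + N ((1 / s) \<cdot>\<^sub>m (H * W + W * D))"
    using N_add[of "K1 * W + W * K2" "(1 / s) \<cdot>\<^sub>m (H * W + W * D)"] by simp
  also have "N (K1 * W + W * K2) \<le> N (K1 * W) + N (W * K2)" by (intro N_add) auto
  also have "N (K1 * W) \<le> (1 / 2) * N W" by (intro N_left K1) auto
  also have "N (W * K2) \<le> (1 / 2 - a / s) * N W" by (intro N_right K2) auto
  also have "N ((1 / s) \<cdot>\<^sub>m (H * W + W * D)) \<le> (1 / s) * N (H * W + W * D)"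
    using unitarily_invariant_norm_smult[OF N, of "1 / s"] s by simp
  finally show ?thesis using s by (simp add: field_simps)
qed

text \<open>The difference splits into a part carrying \<open>W\<close> and two sine parts.
  \<open>W\<close> accounts for \<open>2 * \<kappa> + 2\<close> in the constant, \<open>T\<close>
  and \<open>T'\<close> for 1 each.\<close>

lemma polar_bound:
  assumes "b \<le> \<kappa> * a" "bh \<le> \<kappa> * a"
  shows "N (A * B\<^sup>T - Ah * Bh\<^sup>T) \<le> (2 * \<kappa> + 4) * \<epsilon> / \<delta>"
proof -
  have "a * N W \<le> 2 * \<epsilon> + (b + bh) * (\<epsilon> / \<delta>)"
    using sylvester_bound sylvester_residual_bound by simp
  also have "\<dots> \<le> 2 * (a * (\<epsilon> / \<delta>)) + (2 * \<kappa> * a) * (\<epsilon> / \<delta>)"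
  proof (intro add_mono mult_left_mono mult_right_mono)
    \<comment> \<open>This turns the bare \<open>\<epsilon>\<close> into a multiple of
      \<open>a\<close>, so that \<open>a\<close> can be cancelled from the whole estimate.\<close>
    have "\<delta> \<le> a" using op_bound_nonneg[OF Y2] by simp
    then show "\<epsilon> \<le> a * (\<epsilon> / \<delta>)" using \<delta> \<epsilon>(3) mult_right_mono[of \<delta> a \<epsilon>] by (simp add: field_simps)
  qed (use assms \<epsilon> \<delta> in auto)
  also have "\<dots> = a * ((2 + 2 * \<kappa>) * (\<epsilon> / \<delta>))" by (simp add: algebra_simps)
  finally have W: "N W \<le> (2 + 2 * \<kappa>) * (\<epsilon> / \<delta>)" using a_pos by (simp only: mult_le_cancel_left_pos)
  have eq: "A * B\<^sup>T - Ah * Bh\<^sup>T = A * (W * B\<^sup>T) - A * (M * T'\<^sup>T) - T * Bh\<^sup>T"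
    unfolding W_def M_def K_def T_def T'_def by (rule eq_matI) (auto simp: expand)
  have "N (A * B\<^sup>T - Ah * Bh\<^sup>T) \<le> N (A * (W * B\<^sup>T) - A * (M * T'\<^sup>T)) + N (T * Bh\<^sup>T)"
    unfolding eq by (intro N_diff) auto
  also have "N (A * (W * B\<^sup>T) - A * (M * T'\<^sup>T)) \<le> N (A * (W * B\<^sup>T)) + N (A * (M * T'\<^sup>T))"
    by (intro N_diff) auto
  also have "N (A * (W * B\<^sup>T)) \<le> (2 + 2 * \<kappa>) * (\<epsilon> / \<delta>)"
    by (intro N_left1 N_right1 op_bounds op_bound_transpose W) auto
  also have "N (A * (M * T'\<^sup>T)) \<le> \<epsilon> / \<delta>"
    by (intro N_left1 op_bounds op_bounds') (auto simp: N_transpose sin_theta')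
  also have "N (T * Bh\<^sup>T) \<le> \<epsilon> / \<delta>"
    by (intro N_right1 op_bounds op_bound_transpose sin_theta') auto
  finally show ?thesis by (simp add: algebra_simps add_divide_distrib)
qed

end

section \<open>Split singular value decompositions\<close>

text \<open>The supremum in \<open>op_norm\<close> dominates its members only once they are known to
  be bounded above; the singular value decomposition supplies the bound
  \<open>singular_value_seq A 0\<close>. General vectors then follow by scaling to length 1.\<close>

lemma op_bound_of_op_norm:
  assumes "op_norm A \<le> c"
  shows "op_bound c A"
proof -
  let ?m = "dim_col A" and ?V = "{v \<in> carrier_vec (dim_col A). euclid_norm v \<le> 1}"
  obtain C where C: "op_bound C A"
  proof (rule singular_value_decomposition[of A "dim_row A" ?m])
    fix U V :: "real mat"
    let ?\<sigma> = "singular_value_seq A"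
    assume U: "U \<in> carrier_mat (dim_row A) ?m" "op_bound 1 U"
      and V: "V \<in> carrier_mat ?m ?m" "op_bound 1 V" and A: "A = U * mat_diag ?m ?\<sigma> * V\<^sup>T"
    have "op_bound (1 * ?\<sigma> 0 * 1) (U * mat_diag ?m ?\<sigma> * V\<^sup>T)"
      by (intro op_bound_mult op_bound_transpose op_bound_mat_diag U V)
        (use U V in \<open>auto simp: singular_value_seq_nonneg singular_value_seq_decreasing\<close>)
    then have "op_bound (?\<sigma> 0) A" unfolding A[symmetric] by simp
    then show ?thesis by (rule that)
  qed auto
  have bdd: "bdd_above ((\<lambda>v. euclid_norm (A *\<^sub>v v)) ` ?V)"
  proof (rule bdd_aboveI2)
    fix v assume "v \<in> ?V"
    then have v: "dim_vec v = ?m" "v \<bullet> v \<le> 1" by (auto simp: euclid_norm_def)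
    have "(A *\<^sub>v v) \<bullet> (A *\<^sub>v v) \<le> C\<^sup>2 * (v \<bullet> v)" by (rule op_boundD[OF C v(1)])
    also have "\<dots> \<le> C\<^sup>2 * 1" by (intro mult_left_mono v) auto
    finally show "euclid_norm (A *\<^sub>v v) \<le> C"
      using op_bound_nonneg[OF C] by (simp add: euclid_norm_def real_le_lsqrt)
  qed
  have unit: "euclid_norm (A *\<^sub>v v) \<le> c" if "v \<in> ?V" for v
    using cSUP_upper[OF that bdd] assms unfolding op_norm_def by simp
  \<comment> \<open>The zero vector lies in the unit ball even if \<open>A\<close> has no columns,
    and it forces \<open>0 \<le> c\<close>.\<close>
  have "0\<^sub>v ?m \<in> ?V" by (simp add: euclid_norm_def)
  from unit[OF this] have c: "0 \<le> c"
    by (rule order_trans[rotated]) (simp add: euclid_norm_def scalar_prod_self_nonneg)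
  show ?thesis
    unfolding op_bound_def
  proof (intro conjI ballI c)
    fix v :: "real vec" assume v: "v \<in> carrier_vec ?m"
    show "(A *\<^sub>v v) \<bullet> (A *\<^sub>v v) \<le> c\<^sup>2 * (v \<bullet> v)"
    proof (cases "v \<bullet> v = 0")
      case True
      then show ?thesis using op_boundD[OF C, of v] v by simp
    next
      case False
      then have pos: "0 < v \<bullet> v" using scalar_prod_self_nonneg[of v] by simp
      let ?t = "1 / sqrt (v \<bullet> v)"
      have tt: "?t * ?t = 1 / (v \<bullet> v)" using pos by simp
      have "?t \<cdot>\<^sub>v v \<in> ?V" using v pos by (simp add: euclid_norm_def)
      from unit[OF this] have "sqrt ((?t \<cdot>\<^sub>v (A *\<^sub>v v)) \<bullet> (?t \<cdot>\<^sub>v (A *\<^sub>v v))) \<le> c"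
        using v by (simp add: mult_mat_vec[of A "dim_row A" ?m] euclid_norm_def)
      then have "(?t \<cdot>\<^sub>v (A *\<^sub>v v)) \<bullet> (?t \<cdot>\<^sub>v (A *\<^sub>v v)) \<le> c\<^sup>2"
        using c by (metis real_sqrt_le_iff real_sqrt_abs abs_of_nonneg)
      moreover have "(?t \<cdot>\<^sub>v (A *\<^sub>v v)) \<bullet> (?t \<cdot>\<^sub>v (A *\<^sub>v v)) = ((A *\<^sub>v v) \<bullet> (A *\<^sub>v v)) / (v \<bullet> v)"
        using tt by (simp add: mult.assoc[symmetric])
      ultimately show ?thesis using pos by (simp add: field_simps)
    qed
  qed
qed

lemma orthonormal_cols_append:
  assumes A: "A \<in> carrier_mat p r" and B: "B \<in> carrier_mat p s"
    and orth: "orthonormal_cols (append_cols A B)"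
  shows "A\<^sup>T * A = 1\<^sub>m r" "A\<^sup>T * B = 0\<^sub>m r s" "B\<^sup>T * B = 1\<^sub>m s"
proof -
  let ?M = "append_cols A B"
  have M: "?M \<in> carrier_mat p (r + s)"
    using A B unfolding append_cols_def by auto
  have Mij: "?M $$ (k, i) = (if i < r then A $$ (k, i) else B $$ (k, i - r))" if "k < p" "i < r + s" for k i
    using that A B unfolding append_cols_def by auto
  have eq: "(\<Sum>k<p. ?M $$ (k, i) * ?M $$ (k, j)) = (if i = j then 1 else 0)" if "i < r + s" "j < r + s" for i j
  proof -
    have "(?M\<^sup>T * ?M) $$ (i, j) = (\<Sum>k<p. ?M $$ (k, i) * ?M $$ (k, j))"
      using that M by (simp add: scalar_prod_def atLeast0LessThan)
    moreover have "?M\<^sup>T * ?M = 1\<^sub>m (r + s)" using orth M by (simp add: orthonormal_cols_def)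
    ultimately show ?thesis using that by simp
  qed
  show "A\<^sup>T * A = 1\<^sub>m r"
  proof (rule eq_matI)
    fix i j assume "i < dim_row (1\<^sub>m r :: real mat)" "j < dim_col (1\<^sub>m r :: real mat)"
    then show "(A\<^sup>T * A) $$ (i, j) = 1\<^sub>m r $$ (i, j)"
      using eq[of i j] A by (simp add: scalar_prod_def atLeast0LessThan Mij)
  qed (use A in auto)
  show "A\<^sup>T * B = 0\<^sub>m r s"
  proof (rule eq_matI)
    fix i j assume "i < dim_row (0\<^sub>m r s :: real mat)" "j < dim_col (0\<^sub>m r s :: real mat)"
    then show "(A\<^sup>T * B) $$ (i, j) = 0\<^sub>m r s $$ (i, j)"
      using eq[of i "r + j"] A B by (simp add: scalar_prod_def atLeast0LessThan Mij)
  qed (use A B in auto)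
  show "B\<^sup>T * B = 1\<^sub>m s"
  proof (rule eq_matI)
    fix i j assume "i < dim_row (1\<^sub>m s :: real mat)" "j < dim_col (1\<^sub>m s :: real mat)"
    then show "(B\<^sup>T * B) $$ (i, j) = 1\<^sub>m s $$ (i, j)"
      using eq[of "r + i" "r + j"] A B by (simp add: scalar_prod_def atLeast0LessThan Mij)
  qed (use B in auto)
qed

text \<open>Orthogonality between the leading and the remaining blocks removes the cross terms in
  \<open>A1\<^sup>T * X\<close> and \<open>X * B1\<close>. The residual
  \<open>A2 * D2 * B2\<^sup>T\<close> inherits the bound on \<open>D2\<close> because
  \<open>A2\<close> and \<open>B2\<close> have orthonormal columns.\<close>

lemma split_svdD:
  assumes "split_svd p m r X A1 d B1 A2 D2 B2"
  defines "D \<equiv> mat_diag r (\<lambda>i. d (Suc i))"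
  shows "X \<in> carrier_mat p m" "A1 \<in> carrier_mat p r" "B1 \<in> carrier_mat m r"
    "A1\<^sup>T * A1 = 1\<^sub>m r" "B1\<^sup>T * B1 = 1\<^sub>m r" "A1\<^sup>T * X = D * B1\<^sup>T" "X * B1 = A1 * D"
    "\<And>i. i < r \<Longrightarrow> 0 \<le> d (Suc i)" "\<And>i j. i \<le> j \<Longrightarrow> j < r \<Longrightarrow> d (Suc j) \<le> d (Suc i)"
    "\<And>c. op_norm D2 \<le> c \<Longrightarrow> op_bound c (X - A1 * D * B1\<^sup>T)"
proof -
  obtain s t where X: "X \<in> carrier_mat p m"
    and A1: "A1 \<in> carrier_mat p r" and B1: "B1 \<in> carrier_mat m r"
    and A2: "A2 \<in> carrier_mat p s" and D2: "D2 \<in> carrier_mat s t" and B2: "B2 \<in> carrier_mat m t"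
    and X_eq: "X = A1 * D * B1\<^sup>T + A2 * D2 * B2\<^sup>T"
    and oA: "orthonormal_cols (append_cols A1 A2)" and oB: "orthonormal_cols (append_cols B1 B2)"
    and dd: "decreasing_diagonal (four_block_mat D (0\<^sub>m r t) (0\<^sub>m s r) D2)"
    using assms(1) unfolding split_svd_def Let_def D_def by blast
  note A = orthonormal_cols_append[OF A1 A2 oA] and B = orthonormal_cols_append[OF B1 B2 oB]
  have dims: "dim_row A1 = p" "dim_col A1 = r" "dim_row B1 = m" "dim_col B1 = r"
    "dim_row A2 = p" "dim_col A2 = s" "dim_row B2 = m" "dim_col B2 = t" "dim_row D2 = s" "dim_col D2 = t"
    "dim_row D = r" "dim_col D = r"
    using A1 B1 A2 B2 D2 by (auto simp: D_def)
  have B21: "B2\<^sup>T * B1 = 0\<^sub>m t r"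
    using arg_cong[OF B(2), of transpose_mat] by (simp add: mat_transposes dims)
  show "X \<in> carrier_mat p m" "A1 \<in> carrier_mat p r" "B1 \<in> carrier_mat m r" by fact+
  show "A1\<^sup>T * A1 = 1\<^sub>m r" "B1\<^sup>T * B1 = 1\<^sub>m r" by fact+
  have "A1\<^sup>T * X = (A1\<^sup>T * A1) * (D * B1\<^sup>T) + (A1\<^sup>T * A2) * (D2 * B2\<^sup>T)"
    unfolding X_eq by (simp add: mat_distribs mat_assoc dims del: assoc_mult_mat)
  also have "\<dots> = D * B1\<^sup>T + 0\<^sub>m r m"
    unfolding A using D2 B2 by (simp add: mat_one_mult dims left_mult_zero_mat[of _ s m])
  also have "\<dots> = D * B1\<^sup>T" using B1 by (intro right_add_zero_mat[of _ r m]) (auto simp: D_def)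
  finally show "A1\<^sup>T * X = D * B1\<^sup>T" .
  have "X * B1 = A1 * D * (B1\<^sup>T * B1) + A2 * D2 * (B2\<^sup>T * B1)"
    unfolding X_eq by (simp add: mat_distribs mat_assoc dims del: assoc_mult_mat)
  also have "\<dots> = A1 * D + 0\<^sub>m p r"
    unfolding B B21 using A2 D2 by (simp add: mat_one_mult dims right_mult_zero_mat[of _ p t] del: assoc_mult_mat)
  also have "\<dots> = A1 * D" using A1 by (intro right_add_zero_mat[of _ p r]) (auto simp: D_def)
  finally show "X * B1 = A1 * D" .
  let ?F = "four_block_mat D (0\<^sub>m r t) (0\<^sub>m s r) D2"
  have F: "?F $$ (i, i) = d (Suc i)" "i < min (dim_row ?F) (dim_col ?F)" if "i < r" for i
    using that D2 by (auto simp: D_def mat_diag_def)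
  note nonneg = dd[unfolded decreasing_diagonal_def, THEN conjunct2, THEN conjunct1, rule_format]
    and dec = dd[unfolded decreasing_diagonal_def, THEN conjunct2, THEN conjunct2, rule_format]
  show "0 \<le> d (Suc i)" if "i < r" for i
    using nonneg[OF F(2)[OF that]] by (simp only: F(1)[OF that])
  show "d (Suc j) \<le> d (Suc i)" if "i \<le> j" "j < r" for i j
    using dec[OF that(1) F(2)[OF that(2)]] F(1)[of i] F(1)[of j] that by (simp del: index_mat_four_block)
  fix c assume "op_norm D2 \<le> c"
  then have "op_bound (1 * c * 1) (A2 * D2 * B2\<^sup>T)"
    by (intro op_bound_mult op_bound_transpose op_bound_orthonormal op_bound_of_op_norm)
      (simp_all add: dims A B)
  moreover have "X - A1 * D * B1\<^sup>T = A2 * D2 * B2\<^sup>T"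
    unfolding X_eq by (rule eq_matI) (auto simp: dims simp del: index_mult_mat(1))
  ultimately show "op_bound c (X - A1 * D * B1\<^sup>T)" by simp
qed

text \<open>The shift between \<open>d\<close>, counted from 1, and matrix indices, counted from 0,
  puts the extreme values \<open>d 1\<close> and \<open>d r\<close> at positions 0 and
  \<open>r - 1\<close>; these become \<open>b\<close> and \<open>a\<close>.\<close>

lemma split_svd_perturbation:
  assumes r: "1 \<le> r"
    and X: "split_svd p m r X A1 d B1 A2 D2 B2" and Y: "split_svd p m r Y Ah1 dh Bh1 Ah2 Dh2 Bh2"
    and \<delta>: "0 < \<delta>" and gap: "op_norm Dh2 \<le> d r - \<delta>" and N: "unitarily_invariant_norm N"
  shows "svd_perturbation p m r X Y A1 B1 Ah1 Bh1 (\<lambda>i. d (Suc i)) (\<lambda>i. dh (Suc i)) N (d r) (d 1) (dh 1) \<delta>"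
proof
  show "op_bound (d r - \<delta>) (Y - Ah1 * mat_diag r (\<lambda>i. dh (Suc i)) * Bh1\<^sup>T)"
    by (rule split_svdD(10)[OF Y gap])
  show "d r \<le> d (Suc i)" if "i < r" for i using split_svdD(9)[OF X, of i "r - 1"] that by simp
  show "d (Suc i) \<le> d 1" if "i < r" for i using split_svdD(9)[OF X, of 0 i] that by simp
  show "dh (Suc i) \<le> dh 1" if "i < r" for i using split_svdD(9)[OF Y, of 0 i] that by simp
  show "d r \<le> d 1" using split_svdD(9)[OF X, of 0 "r - 1"] r by simp
  show "0 \<le> dh 1" using split_svdD(8)[OF Y, of 0] r by simp
qed (use split_svdD[OF X] split_svdD[OF Y] \<delta> N in auto)

theorem theorem5:
  shows
  "(\<forall>(p::nat) (m::nat) (r::nat) (X::real mat) (Y::real mat)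
      (A1::real mat) (d::nat \<Rightarrow> real) (B1::real mat) (A2::real mat) (D2::real mat) (B2::real mat)
      (Ah1::real mat) (dh::nat \<Rightarrow> real) (Bh1::real mat) (Ah2::real mat) (Dh2::real mat) (Bh2::real mat)
      (\<delta>::real) (N::real mat \<Rightarrow> real) (\<epsilon>::real).
      1 \<le> r \<longrightarrow>
      split_svd p m r X A1 d B1 A2 D2 B2 \<longrightarrow>
      split_svd p m r Y Ah1 dh Bh1 Ah2 Dh2 Bh2 \<longrightarrow>
      0 < \<delta> \<longrightarrow> \<delta> \<le> d r \<longrightarrow>
      op_norm Dh2 \<le> d r - \<delta> \<longrightarrow>
      unitarily_invariant_norm N \<longrightarrow>
      \<epsilon> = max (N (transpose_mat A1 * (X - Y))) (N ((X - Y) * B1)) \<longrightarrow>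
      N (A1 * mat_diag r (\<lambda>i. d (Suc i)) * transpose_mat B1
          - Ah1 * mat_diag r (\<lambda>i. dh (Suc i)) * transpose_mat Bh1)
        \<le> (sqrt 2 * (d 1 + dh 1) / \<delta> + 1) * \<epsilon>)
   \<and>
   (\<forall>\<kappa>::real. 1 \<le> \<kappa> \<longrightarrow>
     (\<exists>C::real. 0 < C \<and>
      (\<forall>(p::nat) (m::nat) (r::nat) (X::real mat) (Y::real mat)
        (A1::real mat) (d::nat \<Rightarrow> real) (B1::real mat) (A2::real mat) (D2::real mat) (B2::real mat)
        (Ah1::real mat) (dh::nat \<Rightarrow> real) (Bh1::real mat) (Ah2::real mat) (Dh2::real mat) (Bh2::real mat)
        (\<delta>::real) (N::real mat \<Rightarrow> real) (\<epsilon>::real).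
        1 \<le> r \<longrightarrow>
        split_svd p m r X A1 d B1 A2 D2 B2 \<longrightarrow>
        split_svd p m r Y Ah1 dh Bh1 Ah2 Dh2 Bh2 \<longrightarrow>
        0 < \<delta> \<longrightarrow> \<delta> \<le> d r \<longrightarrow>
        op_norm Dh2 \<le> d r - \<delta> \<longrightarrow>
        unitarily_invariant_norm N \<longrightarrow>
        \<epsilon> = max (N (transpose_mat A1 * (X - Y))) (N ((X - Y) * B1)) \<longrightarrow>
        max (d 1) (dh 1) \<le> \<kappa> * d r \<longrightarrow>
        N (A1 * transpose_mat B1 - Ah1 * transpose_mat Bh1) \<le> C * \<epsilon> / \<delta>)))"
proof (intro conjI allI impI)
  fix p m r :: nat and X Y A1 :: "real mat" and d B1 A2 D2 B2 Ah1 dh Bh1 Ah2 Dh2 Bh2 \<delta> N e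
  assume r: "1 \<le> r"
    and X: "split_svd p m r X A1 d B1 A2 D2 B2" and Y: "split_svd p m r Y Ah1 dh Bh1 Ah2 Dh2 Bh2"
    and \<delta>: "0 < \<delta>" and gap: "op_norm Dh2 \<le> d r - \<delta>" and N: "unitarily_invariant_norm N"
    and e: "e = max (N (A1\<^sup>T * (X - Y))) (N ((X - Y) * B1))"
  interpret svd_perturbation p m r X Y A1 B1 Ah1 Bh1 "\<lambda>i. d (Suc i)" "\<lambda>i. dh (Suc i)" N "d r" "d 1" "dh 1" \<delta>
    by (rule split_svd_perturbation[OF r X Y \<delta> gap N])
  \<comment> \<open>\<open>truncation_bound\<close> has the factor 1 in place of
    \<open>sqrt 2\<close>; enlarging it is sound because the sum of singular values and \<epsilon>
    are nonnegative.\<close>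
  have "0 \<le> d 1 + dh 1" using a_pos ab by simp
  moreover have "1 \<le> sqrt (2::real)" by simp
  ultimately have "1 * (d 1 + dh 1) \<le> sqrt 2 * (d 1 + dh 1)" by (rule mult_right_mono[rotated])
  then have "(d 1 + dh 1) / \<delta> + 1 \<le> sqrt 2 * (d 1 + dh 1) / \<delta> + 1"
    using \<delta> by (simp add: divide_right_mono)
  then have "((d 1 + dh 1) / \<delta> + 1) * e \<le> (sqrt 2 * (d 1 + dh 1) / \<delta> + 1) * e"
    using \<epsilon>(3) unfolding \<epsilon>_def e by (rule mult_right_mono)
  then show "N (A1 * mat_diag r (\<lambda>i. d (Suc i)) * B1\<^sup>T - Ah1 * mat_diag r (\<lambda>i. dh (Suc i)) * Bh1\<^sup>T)
      \<le> (sqrt 2 * (d 1 + dh 1) / \<delta> + 1) * e"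
    using truncation_bound unfolding \<epsilon>_def e by (rule order_trans[rotated])
next
  fix \<kappa> :: real assume \<kappa>: "1 \<le> \<kappa>"
  show "\<exists>C>0. \<forall>p m r X Y A1 d B1 A2 D2 B2 Ah1 dh Bh1 Ah2 Dh2 Bh2 \<delta> N \<epsilon>.
      1 \<le> r \<longrightarrow>
      split_svd p m r X A1 d B1 A2 D2 B2 \<longrightarrow>
      split_svd p m r Y Ah1 dh Bh1 Ah2 Dh2 Bh2 \<longrightarrow>
      0 < \<delta> \<longrightarrow> \<delta> \<le> d r \<longrightarrow> op_norm Dh2 \<le> d r - \<delta> \<longrightarrow>
      unitarily_invariant_norm N \<longrightarrow>
      \<epsilon> = max (N (A1\<^sup>T * (X - Y))) (N ((X - Y) * B1)) \<longrightarrow>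
      max (d 1) (dh 1) \<le> \<kappa> * d r \<longrightarrow> N (A1 * B1\<^sup>T - Ah1 * Bh1\<^sup>T) \<le> C * \<epsilon> / \<delta>"
  \<comment> \<open>The witness is the constant of \<open>polar_bound\<close>, which depends on
    \<open>\<kappa>\<close> alone.\<close>
  proof (intro exI[of _ "2 * \<kappa> + 4"] conjI allI impI)
    fix p m r :: nat and X Y A1 :: "real mat" and d B1 A2 D2 B2 Ah1 dh Bh1 Ah2 Dh2 Bh2 \<delta> N e
    assume r: "1 \<le> r"
      and X: "split_svd p m r X A1 d B1 A2 D2 B2" and Y: "split_svd p m r Y Ah1 dh Bh1 Ah2 Dh2 Bh2"
      and \<delta>: "0 < \<delta>" and gap: "op_norm Dh2 \<le> d r - \<delta>" and N: "unitarily_invariant_norm N"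
      and e: "e = max (N (A1\<^sup>T * (X - Y))) (N ((X - Y) * B1))"
      and \<kappa>d: "max (d 1) (dh 1) \<le> \<kappa> * d r"
    interpret svd_perturbation p m r X Y A1 B1 Ah1 Bh1 "\<lambda>i. d (Suc i)" "\<lambda>i. dh (Suc i)" N "d r" "d 1" "dh 1" \<delta>
      by (rule split_svd_perturbation[OF r X Y \<delta> gap N])
    show "N (A1 * B1\<^sup>T - Ah1 * Bh1\<^sup>T) \<le> (2 * \<kappa> + 4) * e / \<delta>"
      using polar_bound[of \<kappa>] \<kappa>d unfolding \<epsilon>_def e by simp
  qed (use \<kappa> in simp)
qed

end
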